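(* Let $G=(V,E)$ be any directed graph with all self-loops (i.e. $i\to i\in E$ for every $i\in V$). If all connected components of $G$ have size at least two, and the components of size two are not the two-cycle, then $G$ is generically locally identifiable from the second- and third-order cumulants.
   Context: $V=\{0,\dots,p-1\}$, $E\subseteq V\times V$; cycles are allowed. Connected components are those of the underlying undirected graph, and size means number of nodes. The two-cycle is the complete directed graph on two nodes, i.e. the graph on two nodes $u\neq v$ with both edges $u\to v$ and $v\to u$ (and both self-loops). $\mathbb{R}^E$ is the set of real $p\times p$ matrices $A=(a_{ji})$ with $a_{ji}=0$ whenever $i\to j\notin E$; $\mathbb{R}^E_{\mathrm{stab}}\subseteq\mathbb{R}^E$ is the subset of Schur stable matrices (all complex eigenvalues of absolute value $<1$). Parameter space: $\Theta=\mathbb{R}^E_{\mathrm{stab}}\times\mathbb{R}_+^p\times(\mathbb{R}\setminus\{0\})^p$, with elements $\theta=(A,\Omega^{(2)},\Omega^{(3)})$, where $\mathbb{R}_+$ denotes the positive reals and the vectors are the diagonals of a diagonal matrix $\Omega^{(2)}$ and a diagonal $p\times p\times p$ tensor $\Omega^{(3)}$. Let $\varphi(\theta)=(S,T)$ be the second- and third-order cumulants, i.e. the unique solutions of $S=ASA^T+\Omega^{(2)}$ and $t_{ijk}=\sum_{l,m,n}a_{il}a_{jm}a_{kn}t_{lmn}+\Omega^{(3)}_{ijk}$. $G$ is (generically) locally identifiable from the second- and third-order cumulants if there is a proper algebraic subset $Z$ of $\Theta$ such that $\varphi^{-1}(\varphi(\theta))$ is finite for all $\theta\in\Theta\setminus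 Z$. *)

theory Defs
  imports "HOL-Analysis.Analysis"
begin

text \<open>
  The node set \<open>{0, ..., p - 1}\<close> is rendered as an arbitrary finite type \<open>'n\<close> with
  \<open>p = CARD('n)\<close>; a directed graph on it is its edge relation, where \<open>(i, j) \<in> E\<close>
  stands for the edge from \<open>i\<close> to \<open>j\<close>.
\<close>

subsection \<open>Graphs\<close>

definition all_self_loops :: "'n rel \<Rightarrow> bool" where
  "all_self_loops E \<longleftrightarrow> (\<forall>i. (i, i) \<in> E)"

definition connected_components :: "'n rel \<Rightarrow> 'n set set" where
  "connected_components E = UNIV // (E \<union> E\<inverse>)\<^sup>*"

definition induced_edges :: "'n rel \<Rightarrow> 'n set \<Rightarrow> 'n rel" where
  "induced_edges E C = E \<inter> (C \<times> C)"

definition is_two_cycle :: "'n set \<Rightarrow> 'n rel \<Rightarrow> bool" where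
  "is_two_cycle C F \<longleftrightarrow>
     (\<exists>u v. u \<noteq> v \<and> C = {u, v} \<and> F = {(u, v), (v, u), (u, u), (v, v)})"


subsection \<open>Parameter space\<close>

definition complex_eigenvalue :: "real ^ 'n ^ 'n \<Rightarrow> complex \<Rightarrow> bool" where
  "complex_eigenvalue A z \<longleftrightarrow>
     (\<exists>v :: complex ^ 'n. v \<noteq> 0 \<and> map_matrix complex_of_real A *v v = z *s v)"

definition schur_stable :: "real ^ 'n ^ 'n \<Rightarrow> bool" where
  "schur_stable A \<longleftrightarrow> (\<forall>z. complex_eigenvalue A z \<longrightarrow> norm z < 1)"

text \<open>The entry in row \<open>j\<close> and column \<open>i\<close> belongs to the edge from \<open>i\<close> to \<open>j\<close>.\<close>

definition graph_matrices :: "'n rel \<Rightarrow> (real ^ 'n ^ 'n) set" where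
  "graph_matrices E = {A. \<forall>i j. (i, j) \<notin> E \<longrightarrow> A $ j $ i = 0}"

definition stable_graph_matrices :: "'n::finite rel \<Rightarrow> (real ^ 'n ^ 'n) set" where
  "stable_graph_matrices E = {A \<in> graph_matrices E. schur_stable A}"

type_synonym 'n param = "(real ^ 'n ^ 'n) \<times> (real ^ 'n) \<times> (real ^ 'n)"

definition parameter_space :: "'n::finite rel \<Rightarrow> 'n param set" where
  "parameter_space E =
     stable_graph_matrices E \<times> {w. \<forall>i. w $ i > 0} \<times> {w. \<forall>i. w $ i \<noteq> 0}"


subsection \<open>Cumulants\<close>

definition diag_matrix :: "real ^ 'n \<Rightarrow> real ^ 'n ^ 'n" where
  "diag_matrix w = (\<chi> i j. if i = j then w $ i else 0)"

definition diag_tensor :: "real ^ 'n \<Rightarrow> real ^ 'n ^ 'n ^ 'n" where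
  "diag_tensor w = (\<chi> i j k. if i = j \<and> j = k then w $ i else 0)"

definition second_cumulant :: "real ^ 'n ^ 'n \<Rightarrow> real ^ 'n \<Rightarrow> real ^ 'n ^ 'n" where
  "second_cumulant A w = (THE S. S = A ** S ** transpose A + diag_matrix w)"

definition third_cumulant :: "real ^ 'n ^ 'n \<Rightarrow> real ^ 'n \<Rightarrow> real ^ 'n ^ 'n ^ 'n" where
  "third_cumulant A w = (THE T. \<forall>i j k.
     T $ i $ j $ k =
       (\<Sum>l\<in>UNIV. \<Sum>m\<in>UNIV. \<Sum>n\<in>UNIV. A $ i $ l * A $ j $ m * A $ k $ n * T $ l $ m $ n)
       + diag_tensor w $ i $ j $ k)"

definition cumulant_map :: "'n::finite param \<Rightarrow> (real ^ 'n ^ 'n) \<times> (real ^ 'n ^ 'n ^ 'n)" where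
  "cumulant_map = (\<lambda>(A, w2, w3). (second_cumulant A w2, third_cumulant A w3))"


subsection \<open>Generic local identifiability\<close>

text \<open>
  On a Euclidean space, \<^const>\<open>real_polynomial_function\<close> describes exactly the polynomials
  in the coordinates.
\<close>

definition algebraic_subset :: "'a::euclidean_space set \<Rightarrow> 'a set \<Rightarrow> bool" where
  "algebraic_subset X Z \<longleftrightarrow>
     (\<exists>P. (\<forall>f\<in>P. real_polynomial_function f) \<and> Z = {x \<in> X. \<forall>f\<in>P. f x = 0})"

definition generically_locally_identifiable :: "'n::finite rel \<Rightarrow> bool" where
  "generically_locally_identifiable E \<longleftrightarrow>
     (\<exists>Z. algebraic_subset (parameter_space E) Z \<and> Z \<subset> parameter_space E \<and>
       (\<forall>\<theta> \<in> parameter_space E - Z.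
          finite {\<theta>' \<in> parameter_space E. cumulant_map \<theta>' = cumulant_map \<theta>}))"

end

theory Submission
  imports Defs "HOL-Computational_Algebra.Fundamental_Theorem_Algebra"
begin

text \<open>
  A parameter space of dimension \<open>n\<close> carries no \<open>n + 1\<close> algebraically independent rational functions.
  So if the cumulant map is an immersion at one point, then \<open>n\<close> linear combinations \<open>f\<close> of
  cumulants form a local diffeomorphism there, every coordinate \<open>c\<close> satisfies a relation
  \<open>\<Sum>k. Q k f * c ^ k = 0\<close> with some polynomial \<open>Q k\<close> not identically zero, and since the image of \<open>f\<close> contains
  an open set, this \<open>Q k\<close> does not vanish generically: generic fibres are finite.

  An immersion point is found near the degenerate parameter \<open>A = 1/2 I\<close>.  Put \<open>A = 1/2 I + e B\<close>, where
  \<open>B\<close> is the adjacency matrix of an orientation of the graph, rescale the off-diagonal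
  entries of kernel vectors of the Jacobian by \<open>e\<close>, and let \<open>e\<close> tend to 0.  The cumulants of type
  \<open>s i j\<close> and \<open>t i i j\<close> then give \<open>\<delta> j = 5 \<delta> i\<close> for the diagonal \<open>\<delta>\<close> of the limiting kernel vector and
  every oriented edge from \<open>i\<close> to \<open>j\<close>, and they express its off-diagonal part by \<open>\<delta>\<close>.  Hence
  one further equation per component suffices; it is the one of \<open>t i j j\<close> for an edge from \<open>i\<close> to \<open>j\<close> that is
  not reversible, or else that of \<open>t i j k\<close> for a vertex \<open>j\<close> with two neighbours \<open>i\<close> and \<open>k\<close>.
\<close>

subsection \<open>Algebraic dependence\<close>

text \<open>Gaussian elimination, one equation per induction step: an unknown \<open>i0\<close> with
  nonzero coefficient in equation \<open>j\<close> is eliminated from the other equations. It serves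
  both for relations among polynomials and for annihilating polynomials of a matrix.\<close>

lemma homogeneous_system_nontrivial:
  fixes a :: "'i \<Rightarrow> 'j \<Rightarrow> 'k::field"
  assumes "finite J" "finite I" "card J < card I"
  shows "\<exists>q. (\<exists>i\<in>I. q i \<noteq> 0) \<and> (\<forall>j\<in>J. (\<Sum>i\<in>I. q i * a i j) = 0)"
  using assms
proof (induction J arbitrary: I a rule: finite_induct)
  case empty
  then obtain i where "i \<in> I" by fastforce
  then show ?case by (intro exI[of _ "\<lambda>_. 1"]) auto
next
  case (insert j J)
  show ?case
  proof (cases "\<forall>i\<in>I. a i j = 0")
    case True
    have "card J < card I" using insert by simp
    from insert.IH[OF insert.prems(1) this, of a] True show ?thesis by auto
  next
    case False
    then obtain i0 where i0: "i0 \<in> I" "a i0 j \<noteq> 0" by auto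
    let ?I = "I - {i0}"
    have "card J < card ?I" using insert i0 by (simp add: card_Diff_singleton)
    from insert.IH[OF _ this, of "\<lambda>i k. a i k - a i j / a i0 j * a i0 k"] insert.prems(1)
    obtain q where q: "\<exists>i\<in>?I. q i \<noteq> 0"
      "\<And>k. k \<in> J \<Longrightarrow> (\<Sum>i\<in>?I. q i * (a i k - a i j / a i0 j * a i0 k)) = 0" by auto
    \<comment> \<open>The value \<open>- r\<close> for the eliminated unknown is the one that
      satisfies equation \<open>j\<close>.\<close>
    define r where "r = (\<Sum>i\<in>?I. q i * a i j) / a i0 j"
    define q' where "q' = q(i0 := - r)"
    have split: "(\<Sum>i\<in>I. q' i * a i k) = - r * a i0 k + (\<Sum>i\<in>?I. q i * a i k)" for k
      using insert.prems(1) i0(1) by (subst sum.remove[of _ i0]) (auto simp: q'_def intro!: sum.cong)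
    have "(\<Sum>i\<in>I. q' i * a i j) = 0"
      using i0(2) by (simp add: split r_def)
    moreover have "(\<Sum>i\<in>I. q' i * a i k) = 0" if "k \<in> J" for k
    proof -
      have "(\<Sum>i\<in>?I. q i * (a i k - a i j / a i0 j * a i0 k))
          = (\<Sum>i\<in>?I. q i * a i k) - (\<Sum>i\<in>?I. q i * a i j * (a i0 k / a i0 j))"
        unfolding sum_subtractf[symmetric] by (intro sum.cong) (auto simp: algebra_simps)
      also have "\<dots> = (\<Sum>i\<in>?I. q i * a i k) - r * a i0 k"
        unfolding sum_distrib_right[symmetric] by (simp add: r_def)
      finally show ?thesis using q(2)[OF that] by (simp add: split)
    qed
    moreover have "\<exists>i\<in>I. q' i \<noteq> 0" using q(1) by (auto simp: q'_def)
    ultimately show ?thesis by (intro exI[of _ q']) auto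
  qed
qed

text \<open>Induction on the variables: with all others fixed, the polynomial in \<open>y i\<close>
  has every element of the infinite set \<open>S i\<close> as a root, so its coefficients vanish,
  and these are polynomials in the remaining variables.\<close>

lemma box_polynomial_coeffs_zero:
  fixes q :: "('i \<Rightarrow> nat) \<Rightarrow> real"
  assumes "finite I" "\<And>i. i \<in> I \<Longrightarrow> infinite (S i)"
    and "\<And>y. (\<And>i. i \<in> I \<Longrightarrow> y i \<in> S i) \<Longrightarrow>
           (\<Sum>e\<in>PiE I (\<lambda>_. {..K}). q e * (\<Prod>i\<in>I. y i ^ e i)) = 0"
    and "e \<in> PiE I (\<lambda>_. {..K})"
  shows "q e = 0"
  using assms
proof (induction I arbitrary: q e rule: finite_induct)
  case empty
  from empty.prems(2)[of "\<lambda>_. 0"] empty.prems(3) show ?case by simp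
next
  case (insert i I)
  let ?B = "PiE I (\<lambda>_. {..K})"
  have fB: "finite ?B" using insert.hyps(1) by (intro finite_PiE) auto
  have expand: "(\<Sum>e\<in>PiE (insert i I) (\<lambda>_. {..K}). q e * (\<Prod>i\<in>insert i I. y i ^ e i))
      = (\<Sum>k\<le>K. (\<Sum>g\<in>?B. q (g(i := k)) * (\<Prod>j\<in>I. y j ^ g j)) * y i ^ k)" for y
  proof -
    have "(\<Sum>e\<in>PiE (insert i I) (\<lambda>_. {..K}). q e * (\<Prod>i\<in>insert i I. y i ^ e i))
      = (\<Sum>(k, g)\<in>{..K} \<times> ?B. q (g(i := k)) * (\<Prod>j\<in>insert i I. y j ^ (g(i := k)) j))"
      unfolding PiE_insert_eq
      using inj_combinator[OF insert.hyps(2), of "\<lambda>_. {..K}"]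
      by (subst sum.reindex) (auto simp: o_def case_prod_unfold)
    also have "\<dots> = (\<Sum>(k, g)\<in>{..K} \<times> ?B. q (g(i := k)) * (\<Prod>j\<in>I. y j ^ g j) * y i ^ k)"
    proof (intro sum.cong refl, clarify)
      fix k g
      have "(\<Prod>j\<in>I. y j ^ (g(i := k)) j) = (\<Prod>j\<in>I. y j ^ g j)"
        using insert.hyps(2) by (intro prod.cong) auto
      then show "q (g(i := k)) * (\<Prod>j\<in>insert i I. y j ^ (g(i := k)) j) = q (g(i := k)) * (\<Prod>j\<in>I. y j ^ g j) * y i ^ k"
        using insert.hyps by simp
    qed
    also have "\<dots> = (\<Sum>k\<le>K. (\<Sum>g\<in>?B. q (g(i := k)) * (\<Prod>j\<in>I. y j ^ g j)) * y i ^ k)"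
      by (simp add: sum.cartesian_product[symmetric] sum_distrib_right)
    finally show ?thesis .
  qed
  have coeff: "(\<Sum>g\<in>?B. q (g(i := k)) * (\<Prod>j\<in>I. y j ^ g j)) = 0"
    if y: "\<And>j. j \<in> I \<Longrightarrow> y j \<in> S j" and k: "k \<le> K" for y k
  proof (rule ccontr)
    let ?c = "\<lambda>k. (\<Sum>g\<in>?B. q (g(i := k)) * (\<Prod>j\<in>I. y j ^ g j))"
    assume "?c k \<noteq> 0"
    then have "finite {z. (\<Sum>k\<le>K. ?c k * z ^ k) = 0}"
      using k by (subst polyfun_finite_roots) auto
    moreover have "S i \<subseteq> {z. (\<Sum>k\<le>K. ?c k * z ^ k) = 0}"
    proof clarify
      fix z assume z: "z \<in> S i"
      have "(\<Sum>k\<le>K. (\<Sum>g\<in>?B. q (g(i := k)) * (\<Prod>j\<in>I. (y(i := z)) j ^ g j)) * (y(i := z)) i ^ k) = 0"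
        by (subst expand[symmetric], rule insert.prems(2)) (use y z in auto)
      moreover have "(\<Prod>j\<in>I. (y(i := z)) j ^ g j) = (\<Prod>j\<in>I. y j ^ g j)" for g
        using insert.hyps(2) by (intro prod.cong) auto
      ultimately show "(\<Sum>k\<le>K. ?c k * z ^ k) = 0" by simp
    qed
    ultimately show False using insert.prems(1)[of i] finite_subset by blast
  qed
  from insert.prems(3) obtain k g where e: "e = g(i := k)" "k \<le> K" "g \<in> ?B"
    by (auto simp: PiE_insert_eq)
  have "q (g(i := k)) = 0"
    using insert.prems(1) coeff e by (intro insert.IH[of "\<lambda>g. q (g(i := k))" g]) auto
  then show ?case using e(1) by (simp only:)
qed

text \<open>The degree is bounded in each coordinate separately, not in total, so the monomials form
  a \<open>PiE\<close> with exactly \<open>(k + 1) ^ DIM('a)\<close> elements.\<close>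

definition box_degree_le :: "nat \<Rightarrow> ('a::euclidean_space \<Rightarrow> real) \<Rightarrow> bool" where
  "box_degree_le k p \<longleftrightarrow>
     (\<exists>a. \<forall>x. p x = (\<Sum>e\<in>PiE Basis (\<lambda>_. {..k}). a e * (\<Prod>b\<in>Basis. (x \<bullet> b) ^ e b)))"

lemma box_degree_le_monomial:
  assumes "\<And>b. b \<in> Basis \<Longrightarrow> e b \<le> k"
  shows "box_degree_le k (\<lambda>x. c * (\<Prod>b\<in>Basis. (x \<bullet> b) ^ e b))"
proof -
  have fin: "finite (PiE Basis (\<lambda>_::'a. {..k}))" by (intro finite_PiE) auto
  \<comment> \<open>Members of \<open>PiE\<close> are extensional, so the exponent function is
    normalised outside \<open>Basis\<close>.\<close>
  have mem: "restrict e Basis \<in> PiE Basis (\<lambda>_::'a. {..k})" using assms by auto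
  have "(\<Sum>e'\<in>PiE Basis (\<lambda>_. {..k}). (if e' = restrict e Basis then c else 0) * (\<Prod>b\<in>Basis. (x \<bullet> b) ^ e' b))
      = c * (\<Prod>b\<in>Basis. (x \<bullet> b) ^ e b)" for x :: 'a
    using fin mem by (simp add: if_distribR sum.delta if_distrib[of "\<lambda>u. u * _"] cong: if_cong)
  then show ?thesis unfolding box_degree_le_def
    by (intro exI[of _ "\<lambda>e'. if e' = restrict e Basis then c else 0"]) simp
qed

lemma box_degree_le_add:
  assumes "box_degree_le k p" "box_degree_le k r"
  shows "box_degree_le k (\<lambda>x. p x + r x)"
proof -
  obtain a a' where "\<And>x. p x = (\<Sum>e\<in>PiE Basis (\<lambda>_. {..k}). a e * (\<Prod>b\<in>Basis. (x \<bullet> b) ^ e b))"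
    "\<And>x. r x = (\<Sum>e\<in>PiE Basis (\<lambda>_. {..k}). a' e * (\<Prod>b\<in>Basis. (x \<bullet> b) ^ e b))"
    using assms unfolding box_degree_le_def by blast
  then show ?thesis unfolding box_degree_le_def
    by (intro exI[of _ "\<lambda>e. a e + a' e"]) (simp add: sum.distrib distrib_right)
qed

lemma box_degree_le_const: "box_degree_le k (\<lambda>x. c)"
  using box_degree_le_monomial[of "\<lambda>_. 0" k c] by simp

lemma box_degree_le_sum:
  assumes "\<And>i. i \<in> I \<Longrightarrow> box_degree_le k (p i)"
  shows "box_degree_le k (\<lambda>x. \<Sum>i\<in>I. p i x)"
  using assms
  by (induction I rule: infinite_finite_induct) (auto intro: box_degree_le_add box_degree_le_const)

lemma box_degree_le_mult:
  assumes "box_degree_le k p" "box_degree_le l r"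
  shows "box_degree_le (k + l) (\<lambda>x. p x * r x)"
proof -
  obtain a a' where *: "\<And>x. p x = (\<Sum>e\<in>PiE Basis (\<lambda>_. {..k}). a e * (\<Prod>b\<in>Basis. (x \<bullet> b) ^ e b))"
    "\<And>x. r x = (\<Sum>e\<in>PiE Basis (\<lambda>_. {..l}). a' e * (\<Prod>b\<in>Basis. (x \<bullet> b) ^ e b))"
    using assms unfolding box_degree_le_def by blast
  have "(\<lambda>x. p x * r x) = (\<lambda>x. \<Sum>e\<in>PiE Basis (\<lambda>_. {..k}). \<Sum>e'\<in>PiE Basis (\<lambda>_. {..l}).
       (a e * a' e') * (\<Prod>b\<in>Basis. (x \<bullet> b) ^ (e b + e' b)))"
    unfolding * sum_product by (simp add: power_add prod.distrib mult_ac)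
  moreover have "box_degree_le (k + l) \<dots>"
    by (intro box_degree_le_sum box_degree_le_monomial) (auto simp: PiE_iff intro!: add_mono)
  ultimately show ?thesis by simp
qed

lemma box_degree_le_mono:
  assumes "box_degree_le k p" "k \<le> l" shows "box_degree_le l p"
  using box_degree_le_mult[OF assms(1) box_degree_le_const[of "l - k" 1]] assms(2) by simp

lemma box_degree_le_prod:
  assumes "finite I" "\<And>i. i \<in> I \<Longrightarrow> box_degree_le k (p i)"
  shows "box_degree_le (card I * k) (\<lambda>x. \<Prod>i\<in>I. p i x)"
  using assms
  by (induction I rule: finite_induct) (auto intro: box_degree_le_mult box_degree_le_const)

lemma box_degree_le_power:
  assumes "box_degree_le k p" shows "box_degree_le (n * k) (\<lambda>x. p x ^ n)"
  by (induction n) (auto intro: box_degree_le_mult[OF assms] box_degree_le_const)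

lemma real_polynomial_function_box_degree:
  assumes "real_polynomial_function p"
  shows "\<exists>k. box_degree_le k p"
  using assms
proof (induction rule: real_polynomial_function.induct)
  case (linear f)
  interpret bounded_linear f by fact
  have "f = (\<lambda>x. \<Sum>i\<in>Basis. f i * (\<Prod>b\<in>Basis. (x \<bullet> b) ^ (if b = i then 1 else 0)))"
  proof
    fix x :: 'a
    have "(\<Prod>b\<in>Basis. (x \<bullet> b) ^ (if b = i then 1 else 0)) = x \<bullet> i" if "i \<in> Basis" for i
    proof -
      have "(\<Prod>b\<in>Basis. (x \<bullet> b) ^ (if b = i then 1 else 0)) = (\<Prod>b\<in>Basis. if b = i then x \<bullet> b else 1)"
        by (intro prod.cong) auto
      then show ?thesis using that by simp
    qed
    moreover have "f x = f (\<Sum>i\<in>Basis. (x \<bullet> i) *\<^sub>R i)" by (simp add: euclidean_representation)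
    ultimately show "f x = (\<Sum>i\<in>Basis. f i * (\<Prod>b\<in>Basis. (x \<bullet> b) ^ (if b = i then 1 else 0)))"
      by (simp add: sum scaleR mult.commute)
  qed
  moreover have "box_degree_le 1 (\<lambda>x. \<Sum>i\<in>Basis. f i * (\<Prod>b\<in>Basis. (x \<bullet> b) ^ (if b = i then 1 else 0)))"
    by (intro box_degree_le_sum box_degree_le_monomial) auto
  ultimately show ?case by (intro exI[of _ 1]) simp
next
  case (const c) show ?case using box_degree_le_const by blast
next
  case (add f g)
  then obtain k l where "box_degree_le k f" "box_degree_le l g" by blast
  then have "box_degree_le (max k l) f" "box_degree_le (max k l) g"
    by (auto intro: box_degree_le_mono)
  then show ?case using box_degree_le_add by blast
next
  case (mult f g) then show ?case using box_degree_le_mult by blast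
qed

text \<open>
  Products of \<open>P i x ^ e i * D x ^ (K - e i)\<close> with all exponents at most \<open>K\<close> have box degree
  \<open>O(K)\<close>, hence live in a space of dimension \<open>O(K ^ DIM('a))\<close>, but there are
  \<open>(K + 1) ^ card I\<close> of them.
\<close>

lemma algebraic_dependence:
  fixes P :: "'i \<Rightarrow> 'a::euclidean_space \<Rightarrow> real"
  assumes I: "finite I" "card I > DIM('a)"
    and P: "\<And>i. i \<in> I \<Longrightarrow> real_polynomial_function (P i)" and D: "real_polynomial_function D"
  obtains K q e0 where "e0 \<in> PiE I (\<lambda>_. {..K})" "q e0 \<noteq> (0::real)"
    "\<And>x. (\<Sum>e\<in>PiE I (\<lambda>_. {..K}). q e * (\<Prod>i\<in>I. P i x ^ e i * D x ^ (K - e i))) = 0"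
proof -
  have "\<forall>i\<in>I. \<exists>k. box_degree_le k (P i)"
    by (intro ballI real_polynomial_function_box_degree P)
  from bchoice[OF this] obtain dP where dP: "\<forall>i\<in>I. box_degree_le (dP i) (P i)" ..
  obtain dD where dD: "box_degree_le dD D" using real_polynomial_function_box_degree[OF D] by blast
  define d where "d = dD + sum dP I"
  have dP': "box_degree_le d (P i)" if "i \<in> I" for i
    using box_degree_le_mono[OF bspec[OF dP that]] member_le_sum[of i I dP] that I(1) by (simp add: d_def trans_le_add2)
  have dD': "box_degree_le d D" using box_degree_le_mono[OF dD] by (simp add: d_def)
  define c where "c = card I"
  define n where "n = DIM('a)"
  \<comment> \<open>Chosen to make the monomials fewer than the products:
    \<open>(c * d * K + 1) ^ n\<close> is at most
    \<open>(c * d + 1) ^ n * (K + 1) ^ n = K * (K + 1) ^ n\<close>, which is below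
    \<open>(K + 1) ^ (n + 1)\<close>.\<close>
  define K where "K = (c * d + 1) ^ n"
  let ?B = "PiE I (\<lambda>_. {..K})"
  let ?M = "PiE (Basis::'a set) (\<lambda>_. {..c * (d * K)})"
  have "box_degree_le (c * (d * K)) (\<lambda>x. \<Prod>i\<in>I. P i x ^ e i * D x ^ (K - e i))" if "e \<in> ?B" for e
    unfolding c_def
  proof (intro box_degree_le_prod I(1))
    fix i assume i: "i \<in> I"
    then have "e i \<le> K" using that by auto
    have "box_degree_le (e i * d + (K - e i) * d) (\<lambda>x. P i x ^ e i * D x ^ (K - e i))"
      by (intro box_degree_le_mult box_degree_le_power dP' dD' i)
    also have "e i * d + (K - e i) * d = d * K"
      using \<open>e i \<le> K\<close> by (metis add_mult_distrib le_add_diff_inverse mult.commute)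
    finally show "box_degree_le (d * K) (\<lambda>x. P i x ^ e i * D x ^ (K - e i))" .
  qed
  then have "\<forall>e\<in>?B. \<exists>a. \<forall>x. (\<Prod>i\<in>I. P i x ^ e i * D x ^ (K - e i))
      = (\<Sum>m\<in>?M. a m * (\<Prod>b\<in>Basis. (x \<bullet> b) ^ m b))"
    by (simp add: box_degree_le_def)
  from bchoice[OF this] obtain a where a: "\<forall>e\<in>?B. \<forall>x. (\<Prod>i\<in>I. P i x ^ e i * D x ^ (K - e i))
      = (\<Sum>m\<in>?M. a e m * (\<Prod>b\<in>Basis. (x \<bullet> b) ^ m b))" ..
  have "card ?M = (c * (d * K) + 1) ^ n" by (simp add: card_PiE n_def)
  also have "\<dots> \<le> ((c * d + 1) * (K + 1)) ^ n" by (intro power_mono) (auto simp: algebra_simps)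
  also have "\<dots> = K * (K + 1) ^ n" unfolding power_mult_distrib K_def by simp
  also have "\<dots> < (K + 1) ^ (n + 1)" by simp
  also have "\<dots> \<le> (K + 1) ^ c" using I(2) by (intro power_increasing) (auto simp: c_def n_def)
  also have "\<dots> = card ?B" by (simp add: card_PiE c_def I(1))
  finally have "card ?M < card ?B" .
  from homogeneous_system_nontrivial[OF _ _ this, of a] I(1) obtain q where
    q: "\<exists>e\<in>?B. q e \<noteq> 0" "\<And>m. m \<in> ?M \<Longrightarrow> (\<Sum>e\<in>?B. q e * a e m) = 0"
    by (auto simp: finite_PiE)
  have "(\<Sum>e\<in>?B. q e * (\<Prod>i\<in>I. P i x ^ e i * D x ^ (K - e i))) = 0" for x
  proof -
    have "(\<Sum>e\<in>?B. q e * (\<Prod>i\<in>I. P i x ^ e i * D x ^ (K - e i)))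
      = (\<Sum>e\<in>?B. \<Sum>m\<in>?M. q e * a e m * (\<Prod>b\<in>Basis. (x \<bullet> b) ^ m b))"
      by (intro sum.cong) (auto simp: a sum_distrib_left mult_ac)
    also have "\<dots> = (\<Sum>m\<in>?M. (\<Sum>e\<in>?B. q e * a e m) * (\<Prod>b\<in>Basis. (x \<bullet> b) ^ m b))"
      by (subst sum.swap) (simp add: sum_distrib_right)
    also have "\<dots> = 0" using q(2) by simp
    finally show ?thesis .
  qed
  with q(1) that show ?thesis by blast
qed

subsection \<open>Finiteness of generic fibres\<close>

text \<open>Sums and products are brought over a common power of \<open>D\<close>. This turns the
  nonvanishing of a polynomial at rational expressions in the parameters into a polynomial condition
  on the parameters.\<close>

lemma real_polynomial_function_clear_denominator:
  fixes D :: "'c::real_normed_vector \<Rightarrow> real" and N :: "'c \<Rightarrow> 'a::euclidean_space"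
  assumes "real_polynomial_function Q" and D: "real_polynomial_function D" and N: "polynomial_function N"
  shows "\<exists>m z. real_polynomial_function z \<and> (\<forall>u. D u \<noteq> 0 \<longrightarrow> z u = D u ^ m * Q (N u /\<^sub>R D u))"
  using assms(1)
proof (induction rule: real_polynomial_function.induct)
  case (linear f)
  have "real_polynomial_function (f \<circ> N)"
    using N[unfolded polynomial_function_def, rule_format, OF linear] .
  then show ?case
    by (intro exI[of _ 1] exI[of _ "f \<circ> N"])
       (simp add: linear_scale[OF bounded_linear.linear[OF linear]] o_def)
next
  case (const c)
  then show ?case by (intro exI[of _ 0] exI[of _ "\<lambda>u. c"]) auto
next
  case (add f g)
  from add.IH(1) obtain m z where z: "real_polynomial_function z \<and> (\<forall>u. D u \<noteq> 0 \<longrightarrow> z u = D u ^ m * f (N u /\<^sub>R D u))"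
    by (elim exE) (rule that)
  from add.IH(2) obtain m' z' where z': "real_polynomial_function z' \<and> (\<forall>u. D u \<noteq> 0 \<longrightarrow> z' u = D u ^ m' * g (N u /\<^sub>R D u))"
    by (elim exE) (rule that)
  show ?case
    by (intro exI[of _ "m + m'"] exI[of _ "\<lambda>u. D u ^ m' * z u + D u ^ m * z' u"] conjI
        real_polynomial_function.intros(3,4) real_polynomial_function_power conjunct1[OF z] conjunct1[OF z'] D)
       (auto simp: z z' power_add algebra_simps)
next
  case (mult f g)
  from mult.IH(1) obtain m z where z: "real_polynomial_function z \<and> (\<forall>u. D u \<noteq> 0 \<longrightarrow> z u = D u ^ m * f (N u /\<^sub>R D u))"
    by (elim exE) (rule that)
  from mult.IH(2) obtain m' z' where z': "real_polynomial_function z' \<and> (\<forall>u. D u \<noteq> 0 \<longrightarrow> z' u = D u ^ m' * g (N u /\<^sub>R D u))"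
    by (elim exE) (rule that)
  show ?case
    by (intro exI[of _ "m + m'"] exI[of _ "\<lambda>u. z u * z' u"] conjI
        real_polynomial_function.intros(3,4) conjunct1[OF z] conjunct1[OF z'] D)
       (auto simp: z z' power_add algebra_simps)
qed

text \<open>Each nonvanishing set is open and meets every nonempty open set, so finitely many of
  them can be intersected with \<open>U\<close> one after the other.\<close>

lemma open_common_nonzero:
  fixes Q :: "'c \<Rightarrow> 'a::topological_space \<Rightarrow> real"
  assumes "finite C" "open U" "U \<noteq> {}"
    and "\<And>c. c \<in> C \<Longrightarrow> continuous_on UNIV (Q c)"
    and "\<And>c V. c \<in> C \<Longrightarrow> open V \<Longrightarrow> V \<noteq> {} \<Longrightarrow> \<exists>y\<in>V. Q c y \<noteq> 0"
  shows "\<exists>y\<in>U. \<forall>c\<in>C. Q c y \<noteq> 0"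
  using assms
proof (induction C arbitrary: U rule: finite_induct)
  case empty then show ?case by auto
next
  case (insert c C)
  let ?V = "U \<inter> Q c -` (- {0})"
  have "open (Q c -` (- {0}))"
    by (rule open_vimage) (auto intro: insert.prems)
  then have "open ?V" using insert.prems by blast
  moreover have "?V \<noteq> {}" using insert.prems(4)[OF _ insert.prems(1,2), of c] by auto
  ultimately show ?case using insert.IH[of ?V] insert.prems by auto
qed

text \<open>Supplies, inside an open set, a grid with infinite sides as required by
  \<open>box_polynomial_coeffs_zero\<close>.\<close>

lemma infinite_open_interval_around: "open U \<Longrightarrow> y \<in> U \<Longrightarrow>
  \<exists>S. (\<forall>b\<in>Basis. infinite (S b)) \<and> (\<forall>c::'a::euclidean_space \<Rightarrow> real. (\<forall>b\<in>Basis. c b \<in> S b) \<longrightarrow> (\<Sum>b\<in>Basis. c b *\<^sub>R b) \<in> (U::'a set))"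
proof -
  assume "open U" "y \<in> U"
  then obtain a b where ab: "y \<in> box a b" "box a b \<subseteq> U" using open_contains_box by metis
  show ?thesis
  proof (intro exI[of _ "\<lambda>i. {a \<bullet> i<..<b \<bullet> i}"] conjI ballI allI impI)
    fix i :: 'a assume "i \<in> Basis"
    then have "a \<bullet> i < b \<bullet> i" using ab(1) by (auto simp: mem_box dest!: bspec[of _ _ i])
    then show "infinite {a \<bullet> i<..<b \<bullet> i}" by (rule infinite_Ioo)
  next
    fix c :: "'a \<Rightarrow> real" assume "\<forall>i\<in>Basis. c i \<in> {a \<bullet> i<..<b \<bullet> i}"
    then have "(\<Sum>b\<in>Basis. c b *\<^sub>R b) \<in> box a b" by (auto simp: mem_box)
    then show "(\<Sum>b\<in>Basis. c b *\<^sub>R b) \<in> U" using ab by blast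
  qed
qed

text \<open>The coordinates of \<open>f\<close> together with \<open>p\<close> are
  \<open>DIM('a) + 1\<close> rational functions, hence satisfy a polynomial relation;
  \<open>Q k\<close> collects its terms of degree \<open>k\<close> in \<open>p\<close>. Taking for
  \<open>k0\<close> the exponent of \<open>p\<close> in a monomial with nonzero coefficient makes
  \<open>Q k0\<close> a nonzero polynomial, which cannot vanish on an open set.\<close>

lemma rational_dependence:
  fixes p :: "'a::euclidean_space \<Rightarrow> real" and f :: "'a \<Rightarrow> 'a"
  assumes D: "real_polynomial_function D"
    and P: "real_polynomial_function P" and F: "polynomial_function F"
    and Pp: "\<And>x. x \<in> X \<Longrightarrow> D x \<noteq> 0 \<and> P x = D x * p x \<and> F x = D x *\<^sub>R f x"
  obtains K Q k0 where "k0 \<le> K"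
    "\<And>k::nat. real_polynomial_function (Q k)"
    "\<And>U. open U \<Longrightarrow> U \<noteq> {} \<Longrightarrow> \<exists>y\<in>U. Q k0 y \<noteq> 0"
    "\<And>x. x \<in> X \<Longrightarrow> (\<Sum>k\<le>K. Q k (f x) * p x ^ k) = 0"
proof -
  define I where "I = insert None (Some ` (Basis :: 'a set))"
  define PP where "PP i = (case i of None \<Rightarrow> P | Some b \<Rightarrow> (\<lambda>x. F x \<bullet> b))" for i
  have fI: "finite I" by (simp add: I_def)
  have cI: "card I = DIM('a) + 1" by (simp add: I_def card_insert_disjoint card_image)
  have pPP: "real_polynomial_function (PP i)" if "i \<in> I" for i
    using that P F by (auto simp: I_def PP_def polynomial_function_iff_Basis_inner)
  have "DIM('a) < card I" using cI by simp
  from fI this pPP D obtain K q e0 where q: "e0 \<in> PiE I (\<lambda>_. {..K})" "q e0 \<noteq> 0"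
    "\<And>x. (\<Sum>e\<in>PiE I (\<lambda>_. {..K}). q e * (\<Prod>i\<in>I. PP i x ^ e i * D x ^ (K - e i))) = 0"
    by (rule algebraic_dependence[of I PP D]) (assumption, rule that)
  let ?B = "PiE I (\<lambda>_. {..K})"
  have fB: "finite ?B" using fI by (intro finite_PiE) auto
  define Q where "Q k y = (\<Sum>e\<in>?B. (if e None = k then q e else 0) * (\<Prod>b\<in>Basis. (y \<bullet> b) ^ e (Some b)))" for k and y :: 'a
  have prodI: "(\<Prod>i\<in>I. h i) = h None * (\<Prod>b\<in>Basis. h (Some b))" for h :: "'a option \<Rightarrow> real"
    unfolding I_def by (subst prod.insert) (auto simp: prod.reindex)
  show thesis
  proof
    show "e0 None \<le> K" using q(1) by (auto simp: I_def)
    show "real_polynomial_function (Q k)" for k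
      unfolding Q_def using fB
      by (intro real_polynomial_function_sum real_polynomial_function.intros(2,4) real_polynomial_function_prod
           real_polynomial_function_power real_polynomial_function.intros(1) bounded_linear_inner_left) auto
    show "(\<Sum>k\<le>K. Q k (f x) * p x ^ k) = 0" if "x \<in> X" for x
    proof -
      have "(\<Sum>k\<le>K. Q k (f x) * p x ^ k) = (\<Sum>e\<in>?B. \<Sum>k\<le>K.
          (if e None = k then q e else 0) * (\<Prod>b\<in>Basis. (f x \<bullet> b) ^ e (Some b)) * p x ^ k)"
        unfolding Q_def sum_distrib_right by (rule sum.swap)
      also have "\<dots> = (\<Sum>e\<in>?B. q e * (\<Prod>b\<in>Basis. (f x \<bullet> b) ^ e (Some b)) * p x ^ e None)"
      proof (intro sum.cong refl)
        fix e assume "e \<in> ?B"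
        then have "e None \<in> {..K}" by (auto simp: I_def)
        then have "(\<Sum>k\<le>K. (if k = e None then q e * (\<Prod>b\<in>Basis. (f x \<bullet> b) ^ e (Some b)) * p x ^ k else 0))
           = q e * (\<Prod>b\<in>Basis. (f x \<bullet> b) ^ e (Some b)) * p x ^ e None"
          by simp
        then show "(\<Sum>k\<le>K. (if e None = k then q e else 0) * (\<Prod>b\<in>Basis. (f x \<bullet> b) ^ e (Some b)) * p x ^ k)
           = q e * (\<Prod>b\<in>Basis. (f x \<bullet> b) ^ e (Some b)) * p x ^ e None"
          by (subst (asm) sum.cong[OF refl, of _ _ "\<lambda>k. (if e None = k then q e else 0) * (\<Prod>b\<in>Basis. (f x \<bullet> b) ^ e (Some b)) * p x ^ k"]) auto
      qed
      \<comment> \<open>The powers of \<open>D\<close> fill each exponent up to \<open>K\<close>, so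
        every monomial carries the same factor \<open>D x ^ (card I * K)\<close>, which is nonzero
        on \<open>X\<close> and can be cancelled.\<close>
      also have "D x ^ (card I * K) * \<dots> = (\<Sum>e\<in>?B. q e * (\<Prod>i\<in>I. PP i x ^ e i * D x ^ (K - e i)))"
        unfolding sum_distrib_left
      proof (intro sum.cong refl)
        fix e assume e: "e \<in> ?B"
        define h where "h i = (case i of None \<Rightarrow> p x | Some b \<Rightarrow> f x \<bullet> b)" for i
        have "(\<Prod>i\<in>I. PP i x ^ e i * D x ^ (K - e i)) = (\<Prod>i\<in>I. D x ^ K * h i ^ e i)"
        proof (intro prod.cong refl)
          fix i assume "i \<in> I"
          then have "e i \<le> K" using e by auto
          have "PP i x = D x * h i"
            using Pp[OF that] by (cases i) (auto simp: PP_def h_def)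
          then show "PP i x ^ e i * D x ^ (K - e i) = D x ^ K * h i ^ e i"
            using \<open>e i \<le> K\<close> by (simp add: power_mult_distrib power_add[symmetric] mult_ac)
        qed
        also have "\<dots> = D x ^ (card I * K) * (\<Prod>i\<in>I. h i ^ e i)"
          by (simp add: prod.distrib power_mult[symmetric] mult.commute)
        finally show "D x ^ (card I * K) * (q e * (\<Prod>b\<in>Basis. (f x \<bullet> b) ^ e (Some b)) * p x ^ e None)
          = q e * (\<Prod>i\<in>I. PP i x ^ e i * D x ^ (K - e i))"
          by (simp add: prodI h_def mult_ac)
      qed
      finally show ?thesis using q(3) Pp[OF that] by simp
    qed
    show "\<exists>y\<in>U. Q (e0 None) y \<noteq> 0" if U: "open U" "U \<noteq> {}" for U
    proof (rule ccontr)
      assume "\<not> ?thesis"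
      then have zero: "\<And>y. y \<in> U \<Longrightarrow> Q (e0 None) y = 0" by blast
      obtain S where S: "\<And>b::'a. b \<in> Basis \<Longrightarrow> infinite (S b)"
        "\<And>c. (\<And>b. b \<in> Basis \<Longrightarrow> c b \<in> S b) \<Longrightarrow> (\<Sum>b\<in>Basis. c b *\<^sub>R b) \<in> U"
      proof -
        from U(2) obtain y where "y \<in> U" by blast
        from infinite_open_interval_around[OF U(1) this] that show thesis by blast
      qed
      \<comment> \<open>\<open>Q (e0 None)\<close> does not involve the variable
        \<open>None\<close>. Multiplied by \<open>y None ^ e0 None\<close> it becomes a polynomial
        in all variables of \<open>I\<close>, and the additional one may range over
        \<open>UNIV\<close>.\<close>
      let ?S = "case_option (UNIV :: real set) S"
      have "(if e0 None = e0 None then q e0 else 0) = 0"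
      proof (rule box_polynomial_coeffs_zero[where I = I and S = ?S and K = K
            and q = "\<lambda>e. if e None = e0 None then q e else 0" and e = e0])
        show "infinite (?S i)" if "i \<in> I" for i
          using that S(1) by (auto simp: I_def infinite_UNIV_char_0 split: option.splits)
        fix y assume y: "\<And>i. i \<in> I \<Longrightarrow> y i \<in> ?S i"
        define w where "w = (\<Sum>b\<in>Basis. y (Some b) *\<^sub>R (b::'a))"
        have "y (Some b) \<in> S b" if "b \<in> Basis" for b
          using y[of "Some b"] that by (auto simp: I_def)
        then have "w \<in> U" unfolding w_def by (rule S(2))
        then have "Q (e0 None) w = 0" by (rule zero)
        have wb: "w \<bullet> b = y (Some b)" if "b \<in> Basis" for b
          using that by (simp add: w_def)
        have "(\<Sum>e\<in>?B. (if e None = e0 None then q e else 0) * (\<Prod>i\<in>I. y i ^ e i))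
            = Q (e0 None) w * y None ^ e0 None"
          unfolding Q_def sum_distrib_right by (intro sum.cong) (auto simp: prodI wb)
        then show "(\<Sum>e\<in>?B. (if e None = e0 None then q e else 0) * (\<Prod>i\<in>I. y i ^ e i)) = 0"
          using \<open>Q (e0 None) w = 0\<close> by simp
      qed (use fI q(1) in auto)
      then show False using q(2) by simp
    qed
  qed
qed

lemma finite_coordinate_product:
  fixes R :: "'a::euclidean_space \<Rightarrow> real set"
  assumes "\<And>b. b \<in> Basis \<Longrightarrow> finite (R b)"
  shows "finite {x. \<forall>b\<in>Basis. x \<bullet> b \<in> R b}"
proof -
  have "{x. \<forall>b\<in>Basis. x \<bullet> b \<in> R b} \<subseteq> (\<lambda>g. \<Sum>b\<in>Basis. g b *\<^sub>R b) ` PiE Basis R"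
  proof
    fix x assume "x \<in> {x. \<forall>b\<in>Basis. x \<bullet> b \<in> R b}"
    then have "restrict (\<lambda>b. x \<bullet> b) Basis \<in> PiE Basis R" by auto
    moreover have "x = (\<Sum>b\<in>Basis. restrict (\<lambda>b. x \<bullet> b) Basis b *\<^sub>R b)"
      by (simp add: euclidean_representation)
    ultimately show "x \<in> (\<lambda>g. \<Sum>b\<in>Basis. g b *\<^sub>R b) ` PiE Basis R" by blast
  qed
  then show ?thesis by (rule finite_subset) (intro finite_imageI finite_PiE finite_Basis assms)
qed

text \<open>\<open>\<Theta>\<close> need not be open in \<open>'a\<close>: it lies in the range of
  the projection \<open>\<pi>\<close>, and \<open>W\<close> is an open set of the whole space that
  \<open>\<pi>\<close> maps into \<open>\<Theta>\<close>. The hypothesis \<open>inj\<close> says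
  that \<open>\<phi>\<close> restricted to this range is an immersion at \<open>x0\<close>.\<close>

lemma generic_finite_fibres:
  fixes \<phi> N :: "'a::euclidean_space \<Rightarrow> 'b::euclidean_space" and D :: "'a \<Rightarrow> real" and \<pi> :: "'a \<Rightarrow> 'a"
  assumes \<pi>: "linear \<pi>" "\<And>x. \<pi> (\<pi> x) = \<pi> x" "\<And>x. x \<in> \<Theta> \<Longrightarrow> \<pi> x = x"
    and D: "real_polynomial_function D" "\<And>x. x \<in> \<Theta> \<Longrightarrow> D x \<noteq> 0"
    and N: "polynomial_function N" "\<And>x. x \<in> \<Theta> \<Longrightarrow> \<phi> x = N x /\<^sub>R D x"
    and W: "open W" "x0 \<in> W" "\<And>x. x \<in> W \<Longrightarrow> \<pi> x \<in> \<Theta>"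
    and inj: "\<And>\<phi>' h. ((\<lambda>x. \<phi> (\<pi> x)) has_derivative \<phi>') (at x0) \<Longrightarrow> \<pi> h = h \<Longrightarrow> \<phi>' h = 0 \<Longrightarrow> h = 0"
  shows "\<exists>z. real_polynomial_function z \<and> (\<exists>x\<in>\<Theta>. z x \<noteq> 0) \<and>
    (\<forall>x\<in>\<Theta>. z x \<noteq> 0 \<longrightarrow> finite {x' \<in> \<Theta>. \<phi> x' = \<phi> x})"
proof -
  have bl\<pi>: "bounded_linear \<pi>" using \<pi>(1) by (simp add: linear_conv_bounded_linear)
  have p\<pi>: "polynomial_function \<pi>" by (rule polynomial_function_bounded_linear[OF bl\<pi>])
  have "N differentiable (at (\<pi> x0))" by (rule differentiable_at_polynomial_function[OF N(1)])
  moreover have "D differentiable (at (\<pi> x0))" by (rule differentiable_at_real_polynomial_function[OF D(1)])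
  ultimately have "(\<lambda>y. N y /\<^sub>R D y) differentiable (at (\<pi> x0))"
    using D(2) W(2,3) by (intro derivative_intros) auto
  then obtain G where G: "((\<lambda>y. N y /\<^sub>R D y) has_derivative G) (at (\<pi> x0))"
    by (auto simp: differentiable_def)
  have "(\<pi> has_derivative \<pi>) (at x0)" by (rule bounded_linear_imp_has_derivative[OF bl\<pi>])
  from has_derivative_compose[OF this G]
  have "((\<lambda>x. N (\<pi> x) /\<^sub>R D (\<pi> x)) has_derivative (\<lambda>h. G (\<pi> h))) (at x0)" .
  then have d\<phi>: "((\<lambda>x. \<phi> (\<pi> x)) has_derivative (\<lambda>h. G (\<pi> h))) (at x0)"
    by (rule has_derivative_transform_within_open[OF _ W(1,2)]) (simp add: N(2) W(3))
  have linG: "linear G" using G has_derivative_linear by blast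
  have sub: "subspace {h. \<pi> h = h}"
    using \<pi>(1) by (auto simp: subspace_def linear_add linear_scale linear_0)
  have "inj_on G {h. \<pi> h = h}"
    using linear_injective_on_subspace_0[OF linG sub] inj[OF d\<phi>] by auto
  from linear_exists_left_inverse_on[OF linG sub this]
  \<comment> \<open>\<open>L\<close> selects as many linear combinations of the values of
    \<open>\<phi>\<close> as \<open>\<pi>\<close> has independent directions.\<close>
  obtain L where L: "linear L" "\<And>h. \<pi> h = h \<Longrightarrow> L (G h) = h" by auto
  have blL: "bounded_linear L" using L(1) by (simp add: linear_conv_bounded_linear)
  \<comment> \<open>The summand \<open>x - \<pi> x\<close> restores the directions killed by
    \<open>\<pi>\<close>, so \<open>f\<close> maps \<open>'a\<close> to itself and its derivative at
    \<open>x0\<close> is the identity.\<close>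
  define f where "f x = L (\<phi> (\<pi> x)) + (x - \<pi> x)" for x
  have df: "(f has_derivative id) (at x0)"
  proof -
    have "(f has_derivative (\<lambda>h. L (G (\<pi> h)) + (h - \<pi> h))) (at x0)"
      unfolding f_def
      by (intro has_derivative_add has_derivative_diff has_derivative_ident
          bounded_linear_imp_has_derivative[OF bl\<pi>] bounded_linear.has_derivative[OF blL d\<phi>])
    then show ?thesis by (simp add: L(2) \<pi>(2) id_def)
  qed
  define F where "F x = L (N (\<pi> x)) + D (\<pi> x) *\<^sub>R (x - \<pi> x)" for x
  have pN\<pi>: "polynomial_function (\<lambda>x. N (\<pi> x))"
    using polynomial_function_compose[OF p\<pi> N(1)] by (simp add: o_def)
  have pD\<pi>: "real_polynomial_function (\<lambda>x. D (\<pi> x))"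
    using D(1) p\<pi> polynomial_function_compose[of \<pi> D] by (simp add: o_def real_polynomial_function_eq)
  have pLN: "polynomial_function (\<lambda>x. L (M x))" if "polynomial_function M" for M :: "'a \<Rightarrow> 'b"
    using polynomial_function_compose[OF that polynomial_function_bounded_linear[OF blL]] by (simp add: o_def)
  have pF: "polynomial_function F"
    unfolding F_def
    using pD\<pi> by (intro polynomial_function_add polynomial_function_mult polynomial_function_diff pLN pN\<pi> p\<pi>
        polynomial_function_id) (auto simp: real_polynomial_function_eq)
  define X where "X = {x. \<pi> x \<in> \<Theta>}"
  have FX: "F x = D (\<pi> x) *\<^sub>R f x" if "x \<in> X" for x
  proof -
    have "N (\<pi> x) = D (\<pi> x) *\<^sub>R \<phi> (\<pi> x)" using that D(2) N(2) by (simp add: X_def)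
    then show ?thesis unfolding F_def f_def using L(1) by (simp add: linear_scale scaleR_add_right)
  qed
  have "continuous_on W f"
  proof -
    have "continuous_on W (\<lambda>x. F x /\<^sub>R D (\<pi> x))"
      using pF pD\<pi> D(2) W(3)
      by (intro continuous_intros continuous_on_polymonial_function)
         (auto simp: real_polynomial_function_eq)
    then show ?thesis
      by (rule continuous_on_eq) (use FX D(2) W(3) in \<open>auto simp: X_def\<close>)
  qed
  \<comment> \<open>This open mapping theorem needs the derivative at the single point
    \<open>x0\<close> only, besides continuity on \<open>W\<close>.\<close>
  then have int: "f x0 \<in> interior (f ` W)"
    by (rule sussmann_open_mapping[OF W(1) _ W(2) df bounded_linear_ident])
       (use W in \<open>auto simp: interior_open id_def\<close>)
  have "\<exists>K Q k0. k0 \<le> K \<and> (\<forall>k::nat. real_polynomial_function (Q k)) \<and>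
      (\<forall>U. open U \<longrightarrow> U \<noteq> {} \<longrightarrow> (\<exists>y\<in>U. Q k0 y \<noteq> 0)) \<and>
      (\<forall>x\<in>X. (\<Sum>k\<le>K. Q k (f x) * (\<pi> x \<bullet> c) ^ k) = 0)" for c
  proof -
    have "real_polynomial_function (\<lambda>x. \<pi> x \<bullet> c)"
      by (intro real_polynomial_function.intros(1) bounded_linear_compose[OF bounded_linear_inner_left bl\<pi>])
    then have "real_polynomial_function (\<lambda>x. D (\<pi> x) * (\<pi> x \<bullet> c))"
      by (rule real_polynomial_function.intros(4)[OF pD\<pi>])
    note pPc = this
    have Pp: "D (\<pi> x) \<noteq> 0 \<and> D (\<pi> x) * (\<pi> x \<bullet> c) = D (\<pi> x) * (\<pi> x \<bullet> c) \<and> F x = D (\<pi> x) *\<^sub>R f x"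
      if "x \<in> X" for x using that FX D(2) by (simp add: X_def)
    obtain K Q k0 where KQ: "k0 \<le> K"
      "\<And>k::nat. real_polynomial_function (Q k)"
      "\<And>U. open U \<Longrightarrow> U \<noteq> {} \<Longrightarrow> \<exists>y\<in>U. Q k0 y \<noteq> 0"
      "\<And>x. x \<in> X \<Longrightarrow> (\<Sum>k\<le>K. Q k (f x) * (\<pi> x \<bullet> c) ^ k) = 0"
      by (rule rational_dependence[OF pD\<pi> pPc pF Pp]) (assumption, rule that)
    show ?thesis
      by (intro exI[of _ K] exI[of _ Q] exI[of _ k0] conjI allI impI ballI KQ)
  qed
  then have "\<forall>c. \<exists>K Q k0. k0 \<le> K \<and> (\<forall>k::nat. real_polynomial_function (Q k)) \<and>
      (\<forall>U. open U \<longrightarrow> U \<noteq> {} \<longrightarrow> (\<exists>y\<in>U. Q k0 y \<noteq> 0)) \<and>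
      (\<forall>x\<in>X. (\<Sum>k\<le>K. Q k (f x) * (\<pi> x \<bullet> c) ^ k) = 0)" by (rule allI)
  then obtain K Q k0 where "\<forall>c. k0 c \<le> K c \<and> (\<forall>k::nat. real_polynomial_function (Q c k)) \<and>
      (\<forall>U. open U \<longrightarrow> U \<noteq> {} \<longrightarrow> (\<exists>y\<in>U. Q c (k0 c) y \<noteq> 0)) \<and>
      (\<forall>x\<in>X. (\<Sum>k\<le>K c. Q c k (f x) * (\<pi> x \<bullet> c) ^ k) = 0)"
    unfolding choice_iff by (elim exE) (rule that, assumption)
  then have Q: "\<And>c. k0 c \<le> K c" "\<And>c k. real_polynomial_function (Q c k)"
    "\<And>c U. open U \<Longrightarrow> U \<noteq> {} \<Longrightarrow> \<exists>y\<in>U. Q c (k0 c) y \<noteq> 0"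
    "\<And>c x. x \<in> X \<Longrightarrow> (\<Sum>k\<le>K c. Q c k (f x) * (\<pi> x \<bullet> c) ^ k) = 0"
    by blast+
  have "\<exists>y\<in>interior (f ` W). \<forall>c\<in>Basis. Q c (k0 c) y \<noteq> 0"
    by (rule open_common_nonzero)
       (use int Q(2,3) in \<open>auto simp: real_polynomial_function_eq intro!: continuous_on_polymonial_function\<close>)
  then obtain x1 where x1: "x1 \<in> W" "\<And>c. c \<in> Basis \<Longrightarrow> Q c (k0 c) (f x1) \<noteq> 0"
    using interior_subset by blast
  \<comment> \<open>On the translate of \<open>\<Theta>\<close> by the fixed vector \<open>v\<close>
    in the kernel of \<open>\<pi>\<close>, \<open>f\<close> depends on the parameter only through
    \<open>\<phi>\<close>, and by the choice of \<open>x1\<close> all the selected coefficients are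
    nonzero somewhere on it.\<close>
  define v where "v = x1 - \<pi> x1"
  have \<pi>v: "\<pi> v = 0" using \<pi> by (simp add: v_def linear_diff)
  have fuv: "f (u + v) = L (\<phi> u) + v" "\<pi> (u + v) = u" "u + v \<in> X" if "u \<in> \<Theta>" for u
    using that \<pi> \<pi>v by (auto simp: f_def X_def linear_add)
  define NN where "NN u = L (N u) + D u *\<^sub>R v" for u
  have pNN: "polynomial_function NN"
    unfolding NN_def using D(1)
    by (intro polynomial_function_add polynomial_function_mult pLN N(1)) (auto simp: real_polynomial_function_eq)
  have NN: "f (u + v) = NN u /\<^sub>R D u" if "u \<in> \<Theta>" for u
    using that D(2)[OF that] L(1) by (simp add: fuv N(2) NN_def linear_scale scaleR_add_right)
  have "\<forall>c. \<exists>m z. real_polynomial_function z \<and> (\<forall>u. D u \<noteq> 0 \<longrightarrow> z u = D u ^ m * Q c (k0 c) (NN u /\<^sub>R D u))"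
    by (intro allI real_polynomial_function_clear_denominator Q(2) D(1) pNN)
  then obtain m zz where "\<forall>c. real_polynomial_function (zz c) \<and>
      (\<forall>u. D u \<noteq> 0 \<longrightarrow> zz c u = D u ^ m c * Q c (k0 c) (NN u /\<^sub>R D u))"
    unfolding choice_iff by (elim exE) (rule that, assumption)
  then have zz: "\<And>c. real_polynomial_function (zz c)"
    "\<And>c u. D u \<noteq> 0 \<Longrightarrow> zz c u = D u ^ m c * Q c (k0 c) (NN u /\<^sub>R D u)" by blast+
  define z where "z u = (\<Prod>c\<in>Basis. zz c u)" for u
  have z0: "z u \<noteq> 0 \<longleftrightarrow> (\<forall>c\<in>Basis. Q c (k0 c) (f (u + v)) \<noteq> 0)" if "u \<in> \<Theta>" for u
    using D(2)[OF that] NN[OF that] by (simp add: z_def zz(2))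
  show ?thesis
  proof (intro exI[of _ z] conjI ballI impI)
    show "real_polynomial_function z" unfolding z_def by (intro real_polynomial_function_prod zz(1)) auto
    show "\<exists>x\<in>\<Theta>. z x \<noteq> 0"
      using x1 z0[OF W(3)[OF x1(1)]] W(3)[OF x1(1)] by (auto simp: v_def)
    fix u assume u: "u \<in> \<Theta>" "z u \<noteq> 0"
    \<comment> \<open>Parameters with the same image under \<open>\<phi>\<close> have the same value
      of \<open>f\<close>, so their \<open>c\<close>-coordinates are roots of one polynomial, whose
      coefficient at \<open>k0 c\<close> is nonzero because \<open>z u \<noteq> 0\<close>.\<close>
    define R where "R c = {t. (\<Sum>k\<le>K c. Q c k (f (u + v)) * t ^ k) = 0}" for c
    have "finite (R c)" if "c \<in> Basis" for c
      unfolding R_def using u z0 that Q(1) by (subst polyfun_finite_roots) blast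
    moreover have "{x' \<in> \<Theta>. \<phi> x' = \<phi> u} \<subseteq> {x. \<forall>b\<in>Basis. x \<bullet> b \<in> R b}"
    proof clarify
      fix x' b assume x': "x' \<in> \<Theta>" "\<phi> x' = \<phi> u"
      then have "f (x' + v) = f (u + v)" using u by (simp add: fuv)
      then show "x' \<bullet> b \<in> R b" using Q(4)[OF fuv(3)[OF x'(1)], of b] x' by (simp add: R_def fuv)
    qed
    ultimately show "finite {x' \<in> \<Theta>. \<phi> x' = \<phi> u}"
      by (rule finite_subset[OF _ finite_coordinate_product[of R], rotated])
  qed
qed

subsection \<open>Powers of Schur stable matrices\<close>

text \<open>The new rate is strictly larger than \<open>norm l\<close> even if
  \<open>r = norm l\<close>; this leaves room to absorb the inhomogeneous term.\<close>

lemma geometric_recurrence_bound: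
  fixes x y :: "nat \<Rightarrow> complex"
  assumes "\<And>k. x (Suc k) = l * x k + y k" "norm l < 1"
    and "0 \<le> r" "r < 1" "\<And>k. norm (y k) \<le> C * r ^ k"
  shows "\<exists>C'. \<forall>k. norm (x k) \<le> C' * (max r ((1 + norm l) / 2)) ^ k"
proof -
  define r' where "r' = max r ((1 + norm l) / 2)"
  have r': "r \<le> r'" "norm l < r'" "r' < 1" using assms by (auto simp: r'_def less_max_iff_disj)
  have "0 \<le> C" using order_trans[OF norm_ge_zero assms(5)[of 0]] by simp
  \<comment> \<open>The first argument covers \<open>k = 0\<close>; the second gives
    \<open>C' * norm l + C \<le> C' * r'\<close>, which carries the bound from \<open>k\<close> to
    \<open>Suc k\<close>.\<close>
  define C' where "C' = max (norm (x 0)) (C / (r' - norm l))"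
  have "C / (r' - norm l) \<le> C'" by (simp add: C'_def)
  then have C': "C \<le> C' * (r' - norm l)" using r' by (simp add: pos_divide_le_eq)
  have "norm (x k) \<le> C' * r' ^ k" for k
  proof (induction k)
    case 0 then show ?case by (simp add: C'_def)
  next
    case (Suc k)
    have "norm (x (Suc k)) \<le> norm l * norm (x k) + norm (y k)"
      unfolding assms(1) by (metis norm_mult norm_triangle_ineq)
    also have "\<dots> \<le> norm l * (C' * r' ^ k) + C * r' ^ k"
    proof (intro add_mono mult_left_mono Suc)
      show "norm (y k) \<le> C * r' ^ k"
        using assms(5)[of k] power_mono[OF r'(1) assms(3), of k] \<open>0 \<le> C\<close>
        by (meson mult_left_mono order_trans)
    qed simp
    also have "\<dots> = (C' * norm l + C) * r' ^ k" by (simp add: algebra_simps)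
    also have "\<dots> \<le> (C' * r') * r' ^ k"
      using C' r' order_trans[OF assms(3) r'(1)] by (intro mult_right_mono) (auto simp: algebra_simps)
    finally show ?case by simp
  qed
  then show ?thesis unfolding r'_def by blast
qed

section \<open>Polynomials of a matrix applied to a vector, and decay of orbits\<close>

definition poly_apply :: "'a::field ^ 'n ^ 'n \<Rightarrow> 'a poly \<Rightarrow> 'a ^ 'n \<Rightarrow> 'a ^ 'n" where
  "poly_apply A p v = (\<Sum>i\<le>degree p. coeff p i *s (((*v) A) ^^ i) v)"

lemma matrix_funpow_diff:
  fixes A :: "'a::field ^ 'n ^ 'n"
  shows
  "(((*v) A) ^^ k) (v - c *s w) = (((*v) A) ^^ k) v - c *s (((*v) A) ^^ k) w"
  by (induction k) (simp_all add: matrix_vector_mult_diff_distrib vector_scalar_commute)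

lemma poly_apply_eq:
  assumes "degree p \<le> n"
  shows "poly_apply A p v = (\<Sum>i\<le>n. coeff p i *s (((*v) A) ^^ i) v)"
  unfolding poly_apply_def using assms
  by (intro sum.mono_neutral_left) (auto simp: coeff_eq_0)

lemma poly_apply_diff:
  "poly_apply A p (v - c *s w) = poly_apply A p v - c *s poly_apply A p w"
  by (simp add: poly_apply_def matrix_funpow_diff vec.scale_right_diff_distrib sum_subtractf vec.scale_sum_right mult.commute)

lemma poly_apply_matrix:
  "poly_apply A p (A *v v) = A *v poly_apply A p v"
proof -
  have "(((*v) A) ^^ i) (A *v v) = A *v ((((*v) A) ^^ i) v)" for i
    by (metis funpow_swap1)
  moreover have "A *v (\<Sum>i\<in>I. f i) = (\<Sum>i\<in>I. A *v f i)" for I and f :: "nat \<Rightarrow> 'a ^ 'b"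
    by (induction I rule: infinite_finite_induct) (simp_all add: matrix_vector_right_distrib)
  ultimately show ?thesis by (simp add: poly_apply_def vector_scalar_commute)
qed

lemma poly_apply_linear_factor:
  "poly_apply A ([:- l, 1:] * q) v = poly_apply A q (A *v v - l *s v)"
proof -
  let ?n = "Suc (degree q)"
  have "degree ([:- l, 1:] * q) \<le> ?n"
    using degree_mult_le[of "[:- l, 1:]" q] by simp
  then have "poly_apply A ([:- l, 1:] * q) v
      = (\<Sum>i\<le>?n. (coeff (pCons 0 q) i - l * coeff q i) *s (((*v) A) ^^ i) v)"
    by (simp add: poly_apply_eq)
  also have "\<dots> = (\<Sum>i\<le>?n. coeff (pCons 0 q) i *s (((*v) A) ^^ i) v)
      - l *s (\<Sum>i\<le>?n. coeff q i *s (((*v) A) ^^ i) v)"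
    by (simp only: vec.scale_left_diff_distrib sum_subtractf vec.scale_sum_right vec.scale_scale)
  also have "(\<Sum>i\<le>?n. coeff q i *s (((*v) A) ^^ i) v) = poly_apply A q v"
    by (rule poly_apply_eq[symmetric]) simp
  also have "(\<Sum>i\<le>?n. coeff (pCons 0 q) i *s (((*v) A) ^^ i) v) = poly_apply A q (A *v v)"
    unfolding poly_apply_def by (subst sum.atMost_Suc_shift) (simp add: funpow_swap1)
  finally show ?thesis by (simp add: poly_apply_diff)
qed

text \<open>Split a root \<open>l\<close> off the annihilating polynomial; the quotient
  \<open>q\<close> annihilates \<open>A *v v - l *s v\<close>. If \<open>norm l \<ge> 1\<close>,
  then \<open>q\<close> applied to \<open>v\<close> would be an eigenvector for \<open>l\<close>
  unless zero, so \<open>q\<close> already annihilates \<open>v\<close>. Otherwise the orbit of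
  \<open>v\<close> satisfies a scalar recurrence with factor \<open>l\<close> whose inhomogeneous
  term decays by induction.\<close>

lemma poly_apply_zero_imp_geometric:
  fixes A :: "complex ^ 'n ^ 'n"
  assumes ev: "\<forall>z v. v \<noteq> 0 \<longrightarrow> A *v v = z *s v \<longrightarrow> norm z < 1"
    and "p \<noteq> 0" "poly_apply A p v = 0"
  shows "\<exists>C r. 0 \<le> r \<and> r < 1 \<and> (\<forall>k i. norm (((((*v) A) ^^ k) v) $ i) \<le> C * r ^ k)"
  using assms(2,3)
proof (induction "degree p" arbitrary: p v)
  case 0
  then have "coeff p 0 \<noteq> 0" "coeff p 0 *s v = 0"
    using leading_coeff_neq_0[of p] by (auto simp: poly_apply_def)
  then have "v = 0" by simp
  have "(((*v) A) ^^ k) 0 = 0" for k by (induction k) auto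
  then show ?case using \<open>v = 0\<close> by (intro exI[of _ 0]) auto
next
  case (Suc n)
  then have "\<not> constant (poly p)" by (simp add: constant_degree)
  then obtain l where "poly p l = 0" using fundamental_theorem_of_algebra by blast
  then obtain q where q: "p = [:- l, 1:] * q" by (auto simp: poly_eq_0_iff_dvd dvd_def)
  have q0: "q \<noteq> 0" using Suc.prems q by auto
  then have "n = degree q" using Suc.hyps(2) by (simp add: q degree_mult_eq del: mult_pCons_left)
  let ?w = "A *v v - l *s v"
  have qw: "poly_apply A q ?w = 0" using Suc.prems by (simp only: q poly_apply_linear_factor)
  show ?case
  proof (cases "norm l < 1")
    case False
    have "A *v poly_apply A q v = l *s poly_apply A q v"
      using qw by (simp add: poly_apply_diff poly_apply_matrix)
    with ev False have "poly_apply A q v = 0" by blast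
    with Suc.hyps(1)[OF \<open>n = degree q\<close> q0] show ?thesis by blast
  next
    case True
    from Suc.hyps(1)[OF \<open>n = degree q\<close> q0 qw] obtain C r where
      r: "0 \<le> r" "r < 1" "\<And>k i. norm (((((*v) A) ^^ k) ?w) $ i) \<le> C * r ^ k" by blast
    let ?r = "max r ((1 + norm l) / 2)"
    have "\<exists>C'. \<forall>k. norm (((((*v) A) ^^ k) v) $ i) \<le> C' * ?r ^ k" for i
    proof (rule geometric_recurrence_bound[OF _ True r(1,2) r(3)[of _ i]])
      fix k
      show "((((*v) A) ^^ Suc k) v) $ i = l * ((((*v) A) ^^ k) v) $ i + ((((*v) A) ^^ k) ?w) $ i"
        by (simp only: matrix_funpow_diff funpow_swap1[symmetric]) simp
    qed
    then have "\<forall>i. \<exists>C'. \<forall>k. norm (((((*v) A) ^^ k) v) $ i) \<le> C' * ?r ^ k" by blast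
    from choice[OF this] obtain C' where
      C': "\<And>k i. norm (((((*v) A) ^^ k) v) $ i) \<le> C' i * ?r ^ k" by blast
    have "norm (((((*v) A) ^^ k) v) $ i) \<le> (\<Sum>i\<in>UNIV. \<bar>C' i\<bar>) * ?r ^ k" for k i
    proof -
      have "C' i \<le> (\<Sum>i\<in>UNIV. \<bar>C' i\<bar>)"
        using member_le_sum[of i UNIV "\<lambda>i. \<bar>C' i\<bar>"] by simp
      then have "C' i * ?r ^ k \<le> (\<Sum>i\<in>UNIV. \<bar>C' i\<bar>) * ?r ^ k"
        using r(1) by (intro mult_right_mono) auto
      then show ?thesis using C'[of k i] by linarith
    qed
    moreover have "0 \<le> ?r" "?r < 1" using r True by auto
    ultimately show ?thesis by blast
  qed
qed

text \<open>The first \<open>CARD('n) + 1\<close> vectors of the orbit of \<open>v\<close> are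
  linearly dependent.\<close>

lemma exists_annihilating_poly:
  fixes A :: "'a::field ^ 'n ^ 'n"
  shows "\<exists>p. p \<noteq> 0 \<and> poly_apply A p v = 0"
proof -
  let ?N = "CARD('n)"
  have "card (UNIV :: 'n set) < card {..?N}" by simp
  from homogeneous_system_nontrivial[OF finite finite_atMost this, of "\<lambda>i j. ((((*v) A) ^^ i) v) $ j"]
  obtain q where q: "(\<exists>i\<in>{..?N}. q i \<noteq> 0) \<and>
    (\<forall>j\<in>UNIV. (\<Sum>i\<le>?N. q i * ((((*v) A) ^^ i) v) $ j) = 0)" ..
  define p where "p = (\<Sum>i\<le>?N. monom (q i) i)"
  have c: "coeff p i = (if i \<le> ?N then q i else 0)" for i
    by (simp add: p_def coeff_sum)
  have "degree p \<le> ?N" using c by (intro degree_le) auto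
  then have "poly_apply A p v = 0"
    using q by (simp add: poly_apply_eq vec_eq_iff c)
  moreover have "p \<noteq> 0"
  proof
    assume "p = 0"
    then have "q i = 0" if "i \<le> ?N" for i using c[of i] that by simp
    with q show False by auto
  qed
  ultimately show ?thesis by blast
qed

text \<open>The eigenvalues are the zeros of the characteristic determinant, which transposition
  preserves.\<close>

lemma schur_stable_transpose: "schur_stable A \<Longrightarrow> schur_stable (transpose A)" for A :: "real ^ 'n ^ 'n"
proof -
  have "complex_eigenvalue A z \<longleftrightarrow> det (map_matrix complex_of_real A - mat z) = 0" for A :: "real ^ 'n ^ 'n" and z
  proof -
    let ?B = "map_matrix complex_of_real A"
    have m: "mat z *v v = z *s v" for v :: "complex ^ 'n"
      by (simp add: vec_eq_iff matrix_vector_mult_def mat_def mult_delta_left)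
    have "complex_eigenvalue A z \<longleftrightarrow> (\<exists>v. v \<noteq> 0 \<and> (?B - mat z) *v v = 0)"
      by (simp add: complex_eigenvalue_def matrix_vector_mult_diff_rdistrib m)
    also have "\<dots> \<longleftrightarrow> \<not> (\<exists>B. B ** (?B - mat z) = mat 1)"
      by (auto simp: matrix_left_invertible_ker)
    also have "\<dots> \<longleftrightarrow> det (?B - mat z) = 0"
      by (metis invertible_det_nz invertible_left_inverse)
    finally show ?thesis .
  qed
  moreover have "map_matrix complex_of_real (transpose A) - mat z
      = transpose (map_matrix complex_of_real A - mat z)" for z
    by (auto simp: vec_eq_iff transpose_def mat_def map_matrix_def)
  ultimately show "schur_stable A \<Longrightarrow> schur_stable (transpose A)"
    by (simp add: schur_stable_def det_transpose)
qed

text \<open>The \<open>k\<close>-th iterate of \<open>axis r 1\<close> is row \<open>r\<close> of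
  the \<open>k\<close>-th power, so this says that the powers of \<open>A\<close> tend to 0. In this
  form stability passes to Kronecker products without computing their eigenvalues.\<close>

definition row_powers_vanish :: "real ^ 'n ^ 'n \<Rightarrow> bool" where
  "row_powers_vanish A \<longleftrightarrow> (\<forall>r j. (\<lambda>k. (((\<lambda>y. y v* A) ^^ k) (axis r 1)) $ j) \<longlonglongrightarrow> 0)"

lemma schur_stable_row_powers_vanish:
  fixes A :: "real ^ 'n ^ 'n"
  assumes "schur_stable A"
  shows "row_powers_vanish A"
proof -
  let ?B = "map_matrix complex_of_real (transpose A)"
  let ?c = "\<lambda>v :: real ^ 'n. (\<chi> i. complex_of_real (v $ i))"
  have pow: "((((*v) ?B) ^^ k) (?c v)) = ?c (((\<lambda>y. y v* A) ^^ k) v)" for k v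
  proof (induction k)
    case (Suc k)
    have "?B *v ?c w = ?c (w v* A)" for w
      by (simp add: vec_eq_iff matrix_vector_mult_def vector_matrix_mult_def transpose_def map_matrix_def mult.commute)
    then show ?case using Suc by simp
  qed simp
  show ?thesis unfolding row_powers_vanish_def
  proof (intro allI)
    fix r j
    from exists_annihilating_poly[of ?B "?c (axis r 1)"]
    obtain p where p: "p \<noteq> 0" "poly_apply ?B p (?c (axis r 1)) = 0" by (elim exE conjE)
    have "\<forall>z v. v \<noteq> 0 \<longrightarrow> ?B *v v = z *s v \<longrightarrow> norm z < 1"
      using schur_stable_transpose[OF assms] by (auto simp: schur_stable_def complex_eigenvalue_def)
    from poly_apply_zero_imp_geometric[OF this p] obtain C s where
      s: "0 \<le> s \<and> s < 1 \<and> (\<forall>k i. norm (((((*v) ?B) ^^ k) (?c (axis r 1))) $ i) \<le> C * s ^ k)"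
      by (elim exE) (rule that)
    have "(\<lambda>k. C * s ^ k) \<longlonglongrightarrow> 0"
      using s by (intro tendsto_mult_right_zero LIMSEQ_realpow_zero) auto
    then show "(\<lambda>k. (((\<lambda>y. y v* A) ^^ k) (axis r 1)) $ j) \<longlonglongrightarrow> 0"
      by (rule Lim_null_comparison[rotated]) (use s in \<open>simp add: pow\<close>)
  qed
qed

text \<open>If \<open>K *v x = x\<close>, the inner product with \<open>x\<close> is constant along
  every orbit of row vectors; starting from \<open>axis r 1\<close> it equals \<open>x $ r\<close>
  and tends to 0.\<close>

lemma row_powers_vanish_det:
  fixes K :: "real ^ 'm ^ 'm"
  assumes "row_powers_vanish K"
  shows "det (mat 1 - K) \<noteq> 0"
proof -
  have "x = 0" if "(mat 1 - K) *v x = 0" for x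
  proof -
    have Kx: "K *v x = x" using that by (simp add: matrix_vector_mult_diff_rdistrib)
    have step: "(y v* K) \<bullet> x = y \<bullet> x" for y
      by (simp add: dot_lmul_matrix Kx)
    have inv: "((\<lambda>y. y v* K) ^^ k) y \<bullet> x = y \<bullet> x" for k y
      by (induction k) (simp_all add: step)
    have "x $ r = 0" for r
    proof -
      have "(\<lambda>k. ((\<lambda>y. y v* K) ^^ k) (axis r 1) \<bullet> x) \<longlonglongrightarrow> (\<Sum>j\<in>UNIV. 0 * x $ j)"
        unfolding inner_vec_def inner_real_def
        using assms by (intro tendsto_intros) (auto simp: row_powers_vanish_def)
      then have "(\<lambda>k::nat. axis r 1 \<bullet> x) \<longlonglongrightarrow> 0" by (simp add: inv)
      then show ?thesis by (simp add: inner_axis' LIMSEQ_const_iff)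
    qed
    then show ?thesis by (simp add: vec_eq_iff)
  qed
  then show ?thesis
    by (metis invertible_det_nz invertible_left_inverse matrix_left_invertible_ker)
qed

subsection \<open>Cumulants by Cramer's rule\<close>

definition kronecker :: "real ^ 'n ^ 'n \<Rightarrow> real ^ 'm ^ 'm \<Rightarrow> real ^ ('n \<times> 'm) ^ ('n \<times> 'm)" where
  "kronecker A B = (\<chi> r c. A $ fst r $ fst c * B $ snd r $ snd c)"

lemma sum_UNIV_prod:
  "(\<Sum>r\<in>UNIV. f r) = (\<Sum>i\<in>UNIV. \<Sum>j\<in>UNIV. f (i :: 'a::finite, j :: 'b::finite))"
  by (simp add: sum.cartesian_product UNIV_Times_UNIV[symmetric] del: UNIV_Times_UNIV)

text \<open>Orbits that start at pure tensors remain pure tensors, with the two factors evolving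
  separately, and the axis vectors are pure.\<close>

lemma row_powers_vanish_kronecker:
  fixes A :: "real ^ 'n ^ 'n" and B :: "real ^ 'm ^ 'm"
  assumes "row_powers_vanish A" "row_powers_vanish B"
  shows "row_powers_vanish (kronecker A B)"
proof -
  let ?t = "\<lambda>(y :: real ^ 'n) (z :: real ^ 'm). \<chi> r. y $ fst r * z $ snd r"
  have step: "?t y z v* kronecker A B = ?t (y v* A) (z v* B)" for y z
    by (simp add: vec_eq_iff vector_matrix_mult_def kronecker_def sum_UNIV_prod sum_product)
       (simp add: mult_ac)
  have pow: "((\<lambda>y. y v* kronecker A B) ^^ k) (?t y z) = ?t (((\<lambda>y. y v* A) ^^ k) y) (((\<lambda>y. y v* B) ^^ k) z)" for k y z
    by (induction k) (simp_all add: step)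
  have ax: "axis r 1 = ?t (axis (fst r) 1) (axis (snd r) 1)" for r
    by (auto simp: vec_eq_iff axis_def prod_eq_iff)
  show ?thesis unfolding row_powers_vanish_def
  proof (intro allI)
    fix r j
    have "(\<lambda>k. (((\<lambda>y. y v* A) ^^ k) (axis (fst r) 1)) $ fst j * (((\<lambda>y. y v* B) ^^ k) (axis (snd r) 1)) $ snd j) \<longlonglongrightarrow> 0 * 0"
      using assms by (intro tendsto_mult) (auto simp: row_powers_vanish_def)
    then show "(\<lambda>k. (((\<lambda>y. y v* kronecker A B) ^^ k) (axis r 1)) $ j) \<longlonglongrightarrow> 0"
      by (simp add: ax[of r] pow)
  qed
qed

text \<open>The solution of \<open>x = K *v x + b\<close> by Cramer's rule. The explicit quotient of
  determinants is what makes the cumulants rational in the parameters.\<close>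

definition stein_solution :: "real ^ 'm ^ 'm \<Rightarrow> real ^ 'm \<Rightarrow> real ^ 'm" where
  "stein_solution K b = (\<chi> k. det (\<chi> i j. if j = k then b $ i else (mat 1 - K) $ i $ j) / det (mat 1 - K))"

lemma stein_solution_iff:
  assumes "det (mat 1 - K) \<noteq> 0"
  shows "x = K *v x + b \<longleftrightarrow> x = stein_solution K b"
proof -
  have "x = K *v x + b \<longleftrightarrow> (mat 1 - K) *v x = b"
    by (auto simp: matrix_vector_mult_diff_rdistrib algebra_simps)
  then show ?thesis unfolding cramer[OF assms] stein_solution_def .
qed

definition kron2 :: "real ^ 'n ^ 'n \<Rightarrow> real ^ ('n \<times> 'n) ^ ('n \<times> 'n)" where
  "kron2 A = kronecker A A"
definition kron3 :: "real ^ 'n ^ 'n \<Rightarrow> real ^ ('n \<times> 'n \<times> 'n) ^ ('n \<times> 'n \<times> 'n)" where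
  "kron3 A = kronecker A (kronecker A A)"

lemma det_kron_nonzero:
  assumes "schur_stable A"
  shows "det (mat 1 - kron2 A) \<noteq> 0" "det (mat 1 - kron3 A) \<noteq> 0"
  using assms unfolding kron2_def kron3_def
  by (intro row_powers_vanish_det row_powers_vanish_kronecker schur_stable_row_powers_vanish; assumption)+

section \<open>The cumulant equations in vectorised form\<close>

lemma matrix_congruence_entry:
  fixes A S :: "real ^ 'n ^ 'n"
  shows "(A ** S ** transpose A) $ i $ j = (\<Sum>l\<in>UNIV. \<Sum>m\<in>UNIV. A $ i $ l * A $ j $ m * S $ l $ m)"
  unfolding matrix_matrix_mult_def transpose_def
  by (simp add: sum_distrib_right sum_distrib_left mult_ac) (rule sum.swap)

lemma second_cumulant_eq_iff:
  "S = A ** S ** transpose A + diag_matrix w \<longleftrightarrow>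
   (\<chi> r. S $ fst r $ snd r) = kron2 A *v (\<chi> r. S $ fst r $ snd r) + (\<chi> r. diag_matrix w $ fst r $ snd r)"
  by (simp add: vec_eq_iff kron2_def kronecker_def matrix_vector_mult_def sum_UNIV_prod split_paired_all
      matrix_congruence_entry)

lemma second_cumulant_solution:
  assumes "det (mat 1 - kron2 A) \<noteq> 0"
  shows "second_cumulant A w = (\<chi> i j. stein_solution (kron2 A) (\<chi> r. diag_matrix w $ fst r $ snd r) $ (i, j))" (is "_ = ?S")
    and "second_cumulant A w = A ** second_cumulant A w ** transpose A + diag_matrix w"
proof -
  have iff: "S = A ** S ** transpose A + diag_matrix w \<longleftrightarrow> S = ?S" for S
    unfolding second_cumulant_eq_iff stein_solution_iff[OF assms]
    by (auto simp: vec_eq_iff)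
  then show *: "second_cumulant A w = ?S"
    unfolding second_cumulant_def by simp
  show "second_cumulant A w = A ** second_cumulant A w ** transpose A + diag_matrix w"
    using iff * by blast
qed

lemma third_cumulant_solution:
  assumes "det (mat 1 - kron3 A) \<noteq> 0"
  shows "third_cumulant A w = (\<chi> i j k. stein_solution (kron3 A) (\<chi> r. diag_tensor w $ fst r $ fst (snd r) $ snd (snd r)) $ (i, j, k))" (is "_ = ?T")
    and "third_cumulant A w $ i $ j $ k = (\<Sum>l\<in>UNIV. \<Sum>m\<in>UNIV. \<Sum>n\<in>UNIV.
           A $ i $ l * A $ j $ m * A $ k $ n * third_cumulant A w $ l $ m $ n) + diag_tensor w $ i $ j $ k"
proof -
  let ?P = "\<lambda>T. \<forall>i j k. T $ i $ j $ k = (\<Sum>l\<in>UNIV. \<Sum>m\<in>UNIV. \<Sum>n\<in>UNIV.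
           A $ i $ l * A $ j $ m * A $ k $ n * T $ l $ m $ n) + diag_tensor w $ i $ j $ k"
  have "?P T \<longleftrightarrow> (\<chi> r. T $ fst r $ fst (snd r) $ snd (snd r))
      = kron3 A *v (\<chi> r. T $ fst r $ fst (snd r) $ snd (snd r)) + (\<chi> r. diag_tensor w $ fst r $ fst (snd r) $ snd (snd r))" for T
    by (simp add: vec_eq_iff kron3_def kronecker_def matrix_vector_mult_def sum_UNIV_prod split_paired_all mult.assoc)
  then have iff: "?P T \<longleftrightarrow> T = ?T" for T
    unfolding stein_solution_iff[OF assms] by (auto simp: vec_eq_iff)
  then show *: "third_cumulant A w = ?T"
    unfolding third_cumulant_def by simp
  show "third_cumulant A w $ i $ j $ k = (\<Sum>l\<in>UNIV. \<Sum>m\<in>UNIV. \<Sum>n\<in>UNIV.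
           A $ i $ l * A $ j $ m * A $ k $ n * third_cumulant A w $ l $ m $ n) + diag_tensor w $ i $ j $ k"
    using iff * by blast
qed

subsection \<open>Limit equations at a degenerate parameter\<close>

text \<open>The action of a matrix on one index of a tensor, with one operator for each of the three
  indices.\<close>

definition op1 :: "('n \<Rightarrow> 'n \<Rightarrow> real) \<Rightarrow> ('n::finite \<Rightarrow> 'n \<Rightarrow> 'n \<Rightarrow> real) \<Rightarrow> 'n \<Rightarrow> 'n \<Rightarrow> 'n \<Rightarrow> real" where
  "op1 c T i j k = (\<Sum>l\<in>UNIV. c i l * T l j k)"
definition op2 :: "('n \<Rightarrow> 'n \<Rightarrow> real) \<Rightarrow> ('n::finite \<Rightarrow> 'n \<Rightarrow> 'n \<Rightarrow> real) \<Rightarrow> 'n \<Rightarrow> 'n \<Rightarrow> 'n \<Rightarrow> real" where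
  "op2 c T i j k = (\<Sum>l\<in>UNIV. c j l * T i l k)"
definition op3 :: "('n \<Rightarrow> 'n \<Rightarrow> real) \<Rightarrow> ('n::finite \<Rightarrow> 'n \<Rightarrow> 'n \<Rightarrow> real) \<Rightarrow> 'n \<Rightarrow> 'n \<Rightarrow> 'n \<Rightarrow> real" where
  "op3 c T i j k = (\<Sum>l\<in>UNIV. c k l * T i j l)"
lemmas op_defs = op1_def op2_def op3_def

lemma sum_delta_plus:
  fixes f c :: "'n::finite \<Rightarrow> real"
  shows "(\<Sum>l\<in>UNIV. ((if i = l then p else 0) + e * c l) * f l) = p * f i + e * (\<Sum>l\<in>UNIV. c l * f l)"
  by (simp add: distrib_right sum.distrib mult_delta_left sum_distrib_left mult.assoc)

text \<open>The diagonal unit tensor. The nested \<open>if\<close> lets sums against it collapse one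
  index at a time.\<close>

definition diag3 :: "'n \<Rightarrow> 'n \<Rightarrow> 'n \<Rightarrow> real" where
  "diag3 i j k = (if i = j then if j = k then 1 else 0 else 0)"

text \<open>Expansion in \<open>e\<close> of a tensor product of three matrices near scalar ones.
  Scalars and matrices are kept separate for the three factors because one factor may be
  \<open>h\<close>, with scalar \<open>d n i\<close>, while the others are \<open>a\<close>, with
  scalar \<open>1/2\<close>.\<close>

lemma triple_sum_expand:
  fixes b1 b2 b3 :: "'n::finite \<Rightarrow> 'n \<Rightarrow> real"
  shows "(\<Sum>l\<in>UNIV. \<Sum>m\<in>UNIV. \<Sum>n\<in>UNIV.
      ((if i = l then p1 else 0) + e * b1 i l) * ((if j = m then p2 else 0) + e * b2 j m) *
      ((if k = n then p3 else 0) + e * b3 k n) * T l m n)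
    = p1 * p2 * p3 * T i j k
      + e * (p2 * p3 * op1 b1 T i j k + p1 * p3 * op2 b2 T i j k + p1 * p2 * op3 b3 T i j k)
      + e^2 * (p3 * op1 b1 (op2 b2 T) i j k + p2 * op1 b1 (op3 b3 T) i j k + p1 * op2 b2 (op3 b3 T) i j k)
      + e^3 * op1 b1 (op2 b2 (op3 b3 T)) i j k"
proof -
  have inner: "(\<Sum>m\<in>UNIV. b2 j m * (p3 * T l m k + e * op3 b3 T l m k)) = p3 * op2 b2 T l j k + e * op2 b2 (op3 b3 T) l j k" for l
    by (simp add: op2_def distrib_left sum.distrib sum_distrib_left mult_ac)
  have outer: "(\<Sum>l\<in>UNIV. b1 i l * (p2 * (p3 * T l j k + e * op3 b3 T l j k) + e * (p3 * op2 b2 T l j k + e * op2 b2 (op3 b3 T) l j k)))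
     = p2 * p3 * op1 b1 T i j k + p2 * e * op1 b1 (op3 b3 T) i j k + e * p3 * op1 b1 (op2 b2 T) i j k + e * e * op1 b1 (op2 b2 (op3 b3 T)) i j k"
    by (simp add: op1_def distrib_left sum.distrib sum_distrib_left mult_ac)
  have "(\<Sum>l\<in>UNIV. \<Sum>m\<in>UNIV. \<Sum>n\<in>UNIV.
      ((if i = l then p1 else 0) + e * b1 i l) * ((if j = m then p2 else 0) + e * b2 j m) *
      ((if k = n then p3 else 0) + e * b3 k n) * T l m n)
    = (\<Sum>l\<in>UNIV. ((if i = l then p1 else 0) + e * b1 i l) * (\<Sum>m\<in>UNIV. ((if j = m then p2 else 0) + e * b2 j m) *
      (\<Sum>n\<in>UNIV. ((if k = n then p3 else 0) + e * b3 k n) * T l m n)))"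
    by (simp only: sum_distrib_left mult.assoc)
  also have "\<dots> = p1 * (p2 * (p3 * T i j k + e * op3 b3 T i j k) + e * (\<Sum>m\<in>UNIV. b2 j m * (p3 * T i m k + e * op3 b3 T i m k)))
     + e * (\<Sum>l\<in>UNIV. b1 i l * (p2 * (p3 * T l j k + e * op3 b3 T l j k) + e * (\<Sum>m\<in>UNIV. b2 j m * (p3 * T l m k + e * op3 b3 T l m k))))"
    unfolding sum_delta_plus op3_def ..
  also have "\<dots> = p1 * (p2 * (p3 * T i j k + e * op3 b3 T i j k) + e * (p3 * op2 b2 T i j k + e * op2 b2 (op3 b3 T) i j k))
     + e * (p2 * p3 * op1 b1 T i j k + p2 * e * op1 b1 (op3 b3 T) i j k
        + e * p3 * op1 b1 (op2 b2 T) i j k + e * e * op1 b1 (op2 b2 (op3 b3 T)) i j k)"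
    unfolding inner outer ..
  finally show ?thesis by (simp add: algebra_simps power2_eq_square power3_eq_cube)
qed

lemma double_sum_expand:
  fixes b1 b2 :: "'n::finite \<Rightarrow> 'n \<Rightarrow> real"
  shows "(\<Sum>l\<in>UNIV. \<Sum>m\<in>UNIV.
      ((if i = l then p1 else 0) + e * b1 i l) * ((if j = m then p2 else 0) + e * b2 j m) * T l m)
    = p1 * p2 * T i j + e * (p2 * (\<Sum>l\<in>UNIV. b1 i l * T l j) + p1 * (\<Sum>m\<in>UNIV. b2 j m * T i m))
      + e^2 * (\<Sum>l\<in>UNIV. \<Sum>m\<in>UNIV. b1 i l * b2 j m * T l m)"
proof -
  have "(\<Sum>l\<in>UNIV. \<Sum>m\<in>UNIV.
      ((if i = l then p1 else 0) + e * b1 i l) * ((if j = m then p2 else 0) + e * b2 j m) * T l m)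
    = (\<Sum>l\<in>UNIV. ((if i = l then p1 else 0) + e * b1 i l) * (\<Sum>m\<in>UNIV. ((if j = m then p2 else 0) + e * b2 j m) * T l m))"
    by (simp only: sum_distrib_left mult.assoc)
  also have "\<dots> = p1 * (p2 * T i j + e * (\<Sum>m\<in>UNIV. b2 j m * T i m))
     + e * (\<Sum>l\<in>UNIV. b1 i l * (p2 * T l j + e * (\<Sum>m\<in>UNIV. b2 j m * T l m)))"
    unfolding sum_delta_plus ..
  also have "(\<Sum>l\<in>UNIV. b1 i l * (p2 * T l j + e * (\<Sum>m\<in>UNIV. b2 j m * T l m)))
     = p2 * (\<Sum>l\<in>UNIV. b1 i l * T l j) + e * (\<Sum>l\<in>UNIV. \<Sum>m\<in>UNIV. b1 i l * b2 j m * T l m)"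
    by (simp add: distrib_left sum.distrib sum_distrib_left mult_ac)
  finally show ?thesis by (simp add: algebra_simps power2_eq_square)
qed

lemma tendsto_ops:
  fixes c :: "nat \<Rightarrow> 'n::finite \<Rightarrow> 'n \<Rightarrow> real"
  assumes "\<And>i j. (\<lambda>n. c n i j) \<longlonglongrightarrow> c0 i j" "\<And>i j k. (\<lambda>n. T n i j k) \<longlonglongrightarrow> T0 i j k"
  shows "(\<lambda>n. op1 (c n) (T n) i j k) \<longlonglongrightarrow> op1 c0 T0 i j k"
    "(\<lambda>n. op2 (c n) (T n) i j k) \<longlonglongrightarrow> op2 c0 T0 i j k"
    "(\<lambda>n. op3 (c n) (T n) i j k) \<longlonglongrightarrow> op3 c0 T0 i j k"
  unfolding op_defs by (intro tendsto_intros assms)+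

lemma op_linear:
  "op1 c (\<lambda>i j k. U i j k + e * V i j k) i j k = op1 c U i j k + e * op1 c V i j k"
  "op2 c (\<lambda>i j k. U i j k + e * V i j k) i j k = op2 c U i j k + e * op2 c V i j k"
  "op3 c (\<lambda>i j k. U i j k + e * V i j k) i j k = op3 c U i j k + e * op3 c V i j k"
  by (simp_all add: op_defs distrib_left sum.distrib sum_distrib_left mult_ac)

text \<open>
  Up to the term \<open>(d i + d j + d k) / 4 * T i j k\<close>, these are the coefficients of \<open>e\<close>, \<open>e\<^sup>2\<close> and \<open>e\<^sup>3\<close> in the
  derivative of \<open>a \<otimes> a \<otimes> a\<close>, applied to \<open>T\<close>, at \<open>a = 1/2 I + e b\<close> in direction \<open>diag d + e c\<close>.
\<close>

definition tan1 :: "('n \<Rightarrow> 'n \<Rightarrow> real) \<Rightarrow> ('n \<Rightarrow> real) \<Rightarrow> ('n \<Rightarrow> 'n \<Rightarrow> real) \<Rightarrow> ('n::finite \<Rightarrow> 'n \<Rightarrow> 'n \<Rightarrow> real) \<Rightarrow> 'n \<Rightarrow> 'n \<Rightarrow> 'n \<Rightarrow> real" where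
  "tan1 b d c T i j k =
     d i * (op2 b T i j k + op3 b T i j k) / 2 + d j * (op1 b T i j k + op3 b T i j k) / 2
     + d k * (op1 b T i j k + op2 b T i j k) / 2
     + (op1 c T i j k + op2 c T i j k + op3 c T i j k) / 4"

definition tan2 :: "('n \<Rightarrow> 'n \<Rightarrow> real) \<Rightarrow> ('n \<Rightarrow> real) \<Rightarrow> ('n \<Rightarrow> 'n \<Rightarrow> real) \<Rightarrow> ('n::finite \<Rightarrow> 'n \<Rightarrow> 'n \<Rightarrow> real) \<Rightarrow> 'n \<Rightarrow> 'n \<Rightarrow> 'n \<Rightarrow> real" where
  "tan2 b d c T i j k =
     d i * op2 b (op3 b T) i j k + d j * op1 b (op3 b T) i j k + d k * op1 b (op2 b T) i j k
     + (op1 c (op2 b T) i j k + op1 c (op3 b T) i j k + op1 b (op2 c T) i j k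
        + op2 c (op3 b T) i j k + op1 b (op3 c T) i j k + op2 b (op3 c T) i j k) / 2"

definition tan3 :: "('n \<Rightarrow> 'n \<Rightarrow> real) \<Rightarrow> ('n \<Rightarrow> real) \<Rightarrow> ('n \<Rightarrow> 'n \<Rightarrow> real) \<Rightarrow> ('n::finite \<Rightarrow> 'n \<Rightarrow> 'n \<Rightarrow> real) \<Rightarrow> 'n \<Rightarrow> 'n \<Rightarrow> 'n \<Rightarrow> real" where
  "tan3 b d c T i j k =
     op1 c (op2 b (op3 b T)) i j k + op1 b (op2 c (op3 b T)) i j k + op1 b (op2 b (op3 c T)) i j k"

lemma tendsto_tan:
  fixes c :: "nat \<Rightarrow> 'n::finite \<Rightarrow> 'n \<Rightarrow> real"
  assumes "\<And>i j. (\<lambda>n. c n i j) \<longlonglongrightarrow> c0 i j" "\<And>i j k. (\<lambda>n. T n i j k) \<longlonglongrightarrow> T0 i j k"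
    and "\<And>i. (\<lambda>n. d n i) \<longlonglongrightarrow> d0 i"
  shows "(\<lambda>n. tan1 b (d n) (c n) (T n) i j k) \<longlonglongrightarrow> tan1 b d0 c0 T0 i j k"
    "(\<lambda>n. tan2 b (d n) (c n) (T n) i j k) \<longlonglongrightarrow> tan2 b d0 c0 T0 i j k"
    "(\<lambda>n. tan3 b (d n) (c n) (T n) i j k) \<longlonglongrightarrow> tan3 b d0 c0 T0 i j k"
  unfolding tan1_def tan2_def tan3_def
  by (intro tendsto_add tendsto_mult tendsto_divide tendsto_const tendsto_ops assms; simp)+

text \<open>
  \<open>a n\<close> tends to \<open>1/2 I\<close>, \<open>S n\<close> and \<open>T n\<close> are its cumulants, normalized so that their limits are identities,
  and \<open>h n\<close> is annihilated by the derivative of the cumulant equations at \<open>a n\<close>.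
\<close>

locale degeneration =
  fixes b :: "'n::finite \<Rightarrow> 'n \<Rightarrow> real" and e :: "nat \<Rightarrow> real"
    and d :: "nat \<Rightarrow> 'n \<Rightarrow> real" and c :: "nat \<Rightarrow> 'n \<Rightarrow> 'n \<Rightarrow> real"
    and d0 :: "'n \<Rightarrow> real" and c0 :: "'n \<Rightarrow> 'n \<Rightarrow> real"
    and S :: "nat \<Rightarrow> 'n \<Rightarrow> 'n \<Rightarrow> real" and T :: "nat \<Rightarrow> 'n \<Rightarrow> 'n \<Rightarrow> 'n \<Rightarrow> real"
    and a h :: "nat \<Rightarrow> 'n \<Rightarrow> 'n \<Rightarrow> real"
  assumes a_def: "\<And>n i j. a n i j = (if i = j then 1/2 else 0) + e n * b i j"
    and h_def: "\<And>n i j. h n i j = (if i = j then d n i else 0) + e n * c n i j"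
    and b_diag: "\<And>i. b i i = 0" and c_diag: "\<And>n i. c n i i = 0"
    and e_nz: "\<And>n. e n \<noteq> 0" and e_lim: "e \<longlonglongrightarrow> 0"
    and d_lim: "\<And>i. (\<lambda>n. d n i) \<longlonglongrightarrow> d0 i" and c_lim: "\<And>i j. (\<lambda>n. c n i j) \<longlonglongrightarrow> c0 i j"
    and S_lim: "\<And>i j. (\<lambda>n. S n i j) \<longlonglongrightarrow> (if i = j then 1 else 0)"
    and T_lim: "\<And>i j k. (\<lambda>n. T n i j k) \<longlonglongrightarrow> diag3 i j k"
    and S_eq: "\<And>n i j. i \<noteq> j \<Longrightarrow> S n i j = (\<Sum>l\<in>UNIV. \<Sum>m\<in>UNIV. a n i l * a n j m * S n l m)"
    and T_eq: "\<And>n i j k. T n i j k = (\<Sum>l\<in>UNIV. \<Sum>m\<in>UNIV. \<Sum>q\<in>UNIV. a n i l * a n j m * a n k q * T n l m q)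
        + 7/8 * diag3 i j k"
    and S_ker: "\<And>n i j. i \<noteq> j \<Longrightarrow>
        (\<Sum>l\<in>UNIV. \<Sum>m\<in>UNIV. h n i l * a n j m * S n l m) + (\<Sum>l\<in>UNIV. \<Sum>m\<in>UNIV. a n i l * h n j m * S n l m) = 0"
    and T_ker: "\<And>n i j k. \<not> (i = j \<and> j = k) \<Longrightarrow>
        (\<Sum>l\<in>UNIV. \<Sum>m\<in>UNIV. \<Sum>q\<in>UNIV. h n i l * a n j m * a n k q * T n l m q)
      + (\<Sum>l\<in>UNIV. \<Sum>m\<in>UNIV. \<Sum>q\<in>UNIV. a n i l * h n j m * a n k q * T n l m q)
      + (\<Sum>l\<in>UNIV. \<Sum>m\<in>UNIV. \<Sum>q\<in>UNIV. a n i l * a n j m * h n k q * T n l m q) = 0"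
begin

section \<open>Expansion of the cumulants and of the kernel equations in powers of
  \<open>e\<close>\<close>

lemma c0_diag: "c0 i i = 0"
  using c_lim[of i i] by (simp add: c_diag LIMSEQ_const_iff)

text \<open>The coefficient of \<open>e\<close> in the third cumulant. The term of order 0 on the
  right of \<open>T_eq\<close> is \<open>T / 8\<close>; solving for \<open>T\<close> divides by
  \<open>7/8\<close>, which turns the coefficients \<open>1/4\<close>, \<open>1/2\<close> and
  \<open>1\<close> of the expansion into \<open>2/7\<close>, \<open>4/7\<close> and
  \<open>8/7\<close>.\<close>

definition T1 :: "'n \<Rightarrow> 'n \<Rightarrow> 'n \<Rightarrow> real" where
  "T1 i j k = 2/7 * (op1 b diag3 i j k + op2 b diag3 i j k + op3 b diag3 i j k)"

definition T1n :: "nat \<Rightarrow> 'n \<Rightarrow> 'n \<Rightarrow> 'n \<Rightarrow> real" where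
  "T1n n i j k = (T n i j k - diag3 i j k) / e n"

lemma T_split: "T n = (\<lambda>i j k. diag3 i j k + e n * T1n n i j k)"
  using e_nz[of n] by (intro ext) (simp add: T1n_def)

lemma T1n_eq: "T1n n i j k = 2/7 * (op1 b (T n) i j k + op2 b (T n) i j k + op3 b (T n) i j k)
    + 4/7 * e n * (op1 b (op2 b (T n)) i j k + op1 b (op3 b (T n)) i j k + op2 b (op3 b (T n)) i j k)
    + 8/7 * (e n)^2 * op1 b (op2 b (op3 b (T n))) i j k"
proof -
  have "T n i j k - diag3 i j k = e n * (2/7 * (op1 b (T n) i j k + op2 b (T n) i j k + op3 b (T n) i j k)
    + 4/7 * e n * (op1 b (op2 b (T n)) i j k + op1 b (op3 b (T n)) i j k + op2 b (op3 b (T n)) i j k)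
    + 8/7 * (e n)^2 * op1 b (op2 b (op3 b (T n))) i j k)"
    using T_eq[of n i j k] unfolding a_def triple_sum_expand
    by (simp add: algebra_simps power2_eq_square power3_eq_cube)
  then show ?thesis using e_nz[of n] by (simp add: T1n_def)
qed

lemma T1n_lim: "(\<lambda>n. T1n n i j k) \<longlonglongrightarrow> T1 i j k"
proof -
  have "(\<lambda>n. T1n n i j k) \<longlonglongrightarrow> 2/7 * (op1 b diag3 i j k + op2 b diag3 i j k + op3 b diag3 i j k)
    + 4/7 * 0 * (op1 b (op2 b diag3) i j k + op1 b (op3 b diag3) i j k + op2 b (op3 b diag3) i j k)
    + 8/7 * 0^2 * op1 b (op2 b (op3 b diag3)) i j k"
    unfolding T1n_eq
    by (intro tendsto_add tendsto_mult tendsto_const tendsto_power tendsto_ops e_lim T_lim)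
  then show ?thesis by (simp add: T1_def)
qed

text \<open>Off the diagonal \<open>T n\<close> is itself a multiple of \<open>e n\<close>, so every
  term of the kernel equation contains this factor and it can be cancelled.\<close>

lemma T_ker_expand:
  assumes "\<not> (i = j \<and> j = k)"
  shows "(d n i + d n j + d n k) / 4 * T1n n i j k + tan1 b (d n) (c n) (T n) i j k
    + e n * tan2 b (d n) (c n) (T n) i j k + (e n)^2 * tan3 b (d n) (c n) (T n) i j k = 0"
proof -
  have "diag3 i j k = 0" using assms by (auto simp: diag3_def)
  then have "T n i j k = e n * T1n n i j k" using e_nz[of n] by (simp add: T1n_def)
  then have "e n * ((d n i + d n j + d n k) / 4 * T1n n i j k + tan1 b (d n) (c n) (T n) i j k
    + e n * tan2 b (d n) (c n) (T n) i j k + (e n)^2 * tan3 b (d n) (c n) (T n) i j k) = 0"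
    using T_ker[OF assms, of n] unfolding a_def h_def triple_sum_expand tan1_def tan2_def tan3_def
    by (simp add: algebra_simps power2_eq_square power3_eq_cube add_divide_distrib)
  then show ?thesis using e_nz[of n] by simp
qed

lemma first_order:
  assumes "\<not> (i = j \<and> j = k)"
  shows "(d0 i + d0 j + d0 k) / 4 * T1 i j k + tan1 b d0 c0 diag3 i j k = 0"
proof -
  have "(\<lambda>n. (d n i + d n j + d n k) / 4 * T1n n i j k + tan1 b (d n) (c n) (T n) i j k
    + e n * tan2 b (d n) (c n) (T n) i j k + (e n)^2 * tan3 b (d n) (c n) (T n) i j k)
    \<longlonglongrightarrow> (d0 i + d0 j + d0 k) / 4 * T1 i j k + tan1 b d0 c0 diag3 i j k
      + 0 * tan2 b d0 c0 diag3 i j k + 0^2 * tan3 b d0 c0 diag3 i j k"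
    by (intro tendsto_add tendsto_mult tendsto_divide tendsto_const tendsto_power tendsto_tan T1n_lim e_lim T_lim c_lim d_lim) simp
  from this[unfolded T_ker_expand[OF assms]] show ?thesis by (simp add: LIMSEQ_const_iff)
qed

definition T2 :: "'n \<Rightarrow> 'n \<Rightarrow> 'n \<Rightarrow> real" where
  "T2 i j k = 2/7 * (op1 b T1 i j k + op2 b T1 i j k + op3 b T1 i j k)
    + 4/7 * (op1 b (op2 b diag3) i j k + op1 b (op3 b diag3) i j k + op2 b (op3 b diag3) i j k)"

text \<open>Where \<open>b\<close> and all \<open>c n\<close> act trivially on the diagonal tensor,
  the first-order equation is void and another factor \<open>e n\<close> can be cancelled. The
  condition on \<open>c n\<close> concerns every \<open>n\<close>, since a mere limit 0 would not
  survive the division.\<close>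

lemma second_order:
  assumes "\<not> (i = j \<and> j = k)"
    and b0: "op1 b diag3 i j k = 0" "op2 b diag3 i j k = 0" "op3 b diag3 i j k = 0"
    and c0: "\<And>n. op1 (c n) diag3 i j k = 0" "\<And>n. op2 (c n) diag3 i j k = 0" "\<And>n. op3 (c n) diag3 i j k = 0"
  shows "(d0 i + d0 j + d0 k) / 4 * T2 i j k + tan1 b d0 c0 T1 i j k + tan2 b d0 c0 diag3 i j k = 0"
proof -
  define T2n where "T2n n = 2/7 * (op1 b (T1n n) i j k + op2 b (T1n n) i j k + op3 b (T1n n) i j k)
    + 4/7 * (op1 b (op2 b (T n)) i j k + op1 b (op3 b (T n)) i j k + op2 b (op3 b (T n)) i j k)
    + 8/7 * e n * op1 b (op2 b (op3 b (T n))) i j k" for n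
  have T2n_lim: "T2n \<longlonglongrightarrow> T2 i j k"
  proof -
    have "T2n \<longlonglongrightarrow> 2/7 * (op1 b T1 i j k + op2 b T1 i j k + op3 b T1 i j k)
    + 4/7 * (op1 b (op2 b diag3) i j k + op1 b (op3 b diag3) i j k + op2 b (op3 b diag3) i j k)
    + 8/7 * 0 * op1 b (op2 b (op3 b diag3)) i j k"
      unfolding T2n_def
      by (intro tendsto_add tendsto_mult tendsto_const tendsto_ops e_lim T_lim T1n_lim)
    then show ?thesis by (simp add: T2_def)
  qed
  have op: "op1 b (T n) i j k = e n * op1 b (T1n n) i j k" "op2 b (T n) i j k = e n * op2 b (T1n n) i j k"
    "op3 b (T n) i j k = e n * op3 b (T1n n) i j k"
    "op1 (c n) (T n) i j k = e n * op1 (c n) (T1n n) i j k" "op2 (c n) (T n) i j k = e n * op2 (c n) (T1n n) i j k"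
    "op3 (c n) (T n) i j k = e n * op3 (c n) (T1n n) i j k" for n
    by (subst T_split, subst op_linear, simp add: b0 c0)+
  have T1n: "T1n n i j k = e n * T2n n" for n
    unfolding T1n_eq[of n i j k] op T2n_def by (simp add: algebra_simps power2_eq_square)
  have tan: "tan1 b (d n) (c n) (T n) i j k = e n * tan1 b (d n) (c n) (T1n n) i j k" for n
    unfolding tan1_def op by (simp add: algebra_simps add_divide_distrib)
  have zero: "(d n i + d n j + d n k) / 4 * T2n n + tan1 b (d n) (c n) (T1n n) i j k
    + tan2 b (d n) (c n) (T n) i j k + e n * tan3 b (d n) (c n) (T n) i j k = 0" for n
  proof -
    have "e n * ((d n i + d n j + d n k) / 4 * T2n n + tan1 b (d n) (c n) (T1n n) i j k
      + tan2 b (d n) (c n) (T n) i j k + e n * tan3 b (d n) (c n) (T n) i j k) = 0"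
      using T_ker_expand[OF assms(1), of n] unfolding T1n tan by (simp add: algebra_simps power2_eq_square)
    then show ?thesis using e_nz[of n] by simp
  qed
  have "(\<lambda>n. (d n i + d n j + d n k) / 4 * T2n n + tan1 b (d n) (c n) (T1n n) i j k
    + tan2 b (d n) (c n) (T n) i j k + e n * tan3 b (d n) (c n) (T n) i j k)
    \<longlonglongrightarrow> (d0 i + d0 j + d0 k) / 4 * T2 i j k + tan1 b d0 c0 T1 i j k + tan2 b d0 c0 diag3 i j k
      + 0 * tan3 b d0 c0 diag3 i j k"
    by (intro tendsto_add tendsto_mult tendsto_divide tendsto_const tendsto_tan T2n_lim T1n_lim e_lim T_lim c_lim d_lim) simp
  from this[unfolded zero] show ?thesis by (simp add: LIMSEQ_const_iff)
qed

text \<open>The analogue of \<open>first_order\<close> for the second cumulant; solving for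
  \<open>S\<close> divides by \<open>3/4\<close>, hence the factors \<open>2/3\<close> and
  \<open>4/3\<close>.\<close>

lemma second_cumulant_order:
  assumes "i \<noteq> j"
  shows "(d0 i + d0 j) / 3 * (b i j + b j i) + d0 i * b j i + d0 j * b i j + (c0 i j + c0 j i) / 2 = 0"
proof -
  define S1n where "S1n n = 2/3 * ((\<Sum>l\<in>UNIV. b i l * S n l j) + (\<Sum>l\<in>UNIV. b j l * S n i l))
      + 4/3 * e n * (\<Sum>l\<in>UNIV. \<Sum>m\<in>UNIV. b i l * b j m * S n l m)" for n
  have S1n: "S n i j = e n * S1n n" for n
    using S_eq[OF assms, of n] unfolding a_def double_sum_expand S1n_def
    by (simp add: algebra_simps power2_eq_square)
  let ?D = "\<lambda>l m :: 'n. (if l = m then 1 else 0) :: real"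
  have "S1n \<longlonglongrightarrow> 2/3 * ((\<Sum>l\<in>UNIV. b i l * ?D l j) + (\<Sum>l\<in>UNIV. b j l * ?D i l))
      + 4/3 * 0 * (\<Sum>l\<in>UNIV. \<Sum>m\<in>UNIV. b i l * b j m * ?D l m)"
    unfolding S1n_def by (intro tendsto_intros e_lim S_lim)
  then have S1n_lim: "S1n \<longlonglongrightarrow> 2/3 * (b i j + b j i)" by (simp add: mult_delta_right)
  let ?K = "\<lambda>n. (d n i + d n j) / 2 * S1n n
     + (d n j * (\<Sum>l\<in>UNIV. b i l * S n l j) + d n i * (\<Sum>l\<in>UNIV. b j l * S n i l))
     + ((\<Sum>l\<in>UNIV. c n i l * S n l j) + (\<Sum>l\<in>UNIV. c n j l * S n i l)) / 2
     + e n * ((\<Sum>l\<in>UNIV. \<Sum>m\<in>UNIV. c n i l * b j m * S n l m) + (\<Sum>l\<in>UNIV. \<Sum>m\<in>UNIV. b i l * c n j m * S n l m))"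
  have "e n * ?K n = 0" for n
    using S_ker[OF assms, of n] unfolding a_def h_def double_sum_expand S1n
    by (simp add: algebra_simps power2_eq_square add_divide_distrib)
  then have K: "?K = (\<lambda>n. 0)" using e_nz by simp
  have "?K \<longlonglongrightarrow> (d0 i + d0 j) / 2 * (2/3 * (b i j + b j i))
     + (d0 j * (\<Sum>l\<in>UNIV. b i l * ?D l j) + d0 i * (\<Sum>l\<in>UNIV. b j l * ?D i l))
     + ((\<Sum>l\<in>UNIV. c0 i l * ?D l j) + (\<Sum>l\<in>UNIV. c0 j l * ?D i l)) / 2
     + 0 * ((\<Sum>l\<in>UNIV. \<Sum>m\<in>UNIV. c0 i l * b j m * ?D l m) + (\<Sum>l\<in>UNIV. \<Sum>m\<in>UNIV. b i l * c0 j m * ?D l m))"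
    by (intro tendsto_intros e_lim S_lim S1n_lim c_lim d_lim) simp_all
  then show ?thesis unfolding K by (simp add: mult_delta_right LIMSEQ_const_iff algebra_simps add_divide_distrib)
qed

text \<open>The equation of type \<open>t i i j\<close> contains \<open>c0 j i\<close> as its only
  off-diagonal unknown. In particular \<open>c0\<close> vanishes wherever \<open>b\<close>
  does.\<close>

lemma off_diagonal_tangent:
  assumes "i \<noteq> j"
  shows "c0 j i = - b j i * (32 * d0 i + 2 * d0 j) / 7"
proof -
  have "(d0 i + d0 i + d0 j) / 4 * T1 i i j + tan1 b d0 c0 diag3 i i j = 0"
    using assms by (intro first_order) auto
  then show ?thesis using assms
    by (simp add: T1_def tan1_def op_defs diag3_def mult_delta_right b_diag c0_diag field_simps)
qed

section \<open>The limit equations at single edges and at forks\<close>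

lemma T1_eq: "T1 i j k = 2/7 * ((if j = k then b i j else 0) + (if i = k then b j i else 0) + (if i = j then b k i else 0))"
  by (simp add: T1_def op_defs diag3_def mult_delta_right)

lemma op_diag3:
  "op1 x diag3 i j k = (if j = k then x i j else 0)"
  "op2 x diag3 i j k = (if i = k then x j i else 0)"
  "op3 x diag3 i j k = (if i = j then x k i else 0)"
  by (simp_all add: op_defs diag3_def mult_delta_right)

lemma op_op_diag3:
  "op1 x (op2 y diag3) i j k = x i k * y j k"
  "op1 x (op3 y diag3) i j k = x i j * y k j"
  "op2 x (op3 y diag3) i j k = x j i * y k i"
  unfolding op_diag3 by (simp_all add: op1_def op2_def op_diag3 mult_delta_right)

lemma op_T1:
  "op1 x T1 i j k = 2/7 * ((if j = k then \<Sum>l\<in>UNIV. x i l * b l j else 0) + x i k * b j k + x i j * b k j)"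
  "op2 x T1 i j k = 2/7 * (x j k * b i k + (if i = k then \<Sum>l\<in>UNIV. x j l * b l i else 0) + x j i * b k i)"
  "op3 x T1 i j k = 2/7 * (x k j * b i j + x k i * b j i + (if i = j then \<Sum>l\<in>UNIV. x k l * b l i else 0))"
proof -
  have scale: "(\<Sum>l\<in>UNIV. f l * (2/7 * (g1 l + g2 l + g3 l)))
      = 2/7 * ((\<Sum>l\<in>UNIV. f l * g1 l) + (\<Sum>l\<in>UNIV. f l * g2 l) + (\<Sum>l\<in>UNIV. f l * g3 l))"
    for f g1 g2 g3 :: "'n \<Rightarrow> real"
    unfolding sum.distrib[symmetric] sum_distrib_left by (intro sum.cong refl) (simp add: algebra_simps add_divide_distrib)
  show "op1 x T1 i j k = 2/7 * ((if j = k then \<Sum>l\<in>UNIV. x i l * b l j else 0) + x i k * b j k + x i j * b k j)"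
    "op2 x T1 i j k = 2/7 * (x j k * b i k + (if i = k then \<Sum>l\<in>UNIV. x j l * b l i else 0) + x j i * b k i)"
    "op3 x T1 i j k = 2/7 * (x k j * b i j + x k i * b j i + (if i = j then \<Sum>l\<in>UNIV. x k l * b l i else 0))"
    unfolding op_defs T1_eq scale by (simp_all add: mult_delta_right)
qed

text \<open>For an edge oriented from \<open>i\<close> to \<open>j\<close>, the equations of type
  \<open>t i i j\<close> and \<open>s i j\<close> both express \<open>c0 j i\<close> by the
  diagonal; equating them leaves \<open>d0 j = 5 * d0 i\<close>.\<close>

lemma edge_relation:
  assumes "i \<noteq> j" "b j i = 1" "b i j = 0"
  shows "d0 j = 5 * d0 i" "c0 j i = - 6 * d0 i" "c0 i j = 0"
proof -
  show ij: "c0 i j = 0" using off_diagonal_tangent[of j i] assms by simp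
  have "c0 j i = - (32 * d0 i + 2 * d0 j) / 7" using off_diagonal_tangent[of i j] assms by simp
  moreover have "(d0 i + d0 j) / 3 + d0 i + c0 j i / 2 = 0"
    using second_cumulant_order[of i j] ij assms by simp
  ultimately show "d0 j = 5 * d0 i" "c0 j i = - 6 * d0 i" by (simp_all add: field_simps)
qed

text \<open>The second-order equation of type \<open>t i j j\<close>. The assumption
  \<open>path\<close> excludes oriented two-step walks from \<open>j\<close> back to
  \<open>i\<close> and so removes all sums over a third vertex; with \<open>edge_relation\<close>
  the rest is \<open>- 104/49 * d0 i = 0\<close>.\<close>

lemma single_edge_vanish:
  assumes ij: "i \<noteq> j" "b j i = 1" "b i j = 0" "\<And>n. c n i j = 0"
    and path: "\<And>l. b i l * b l j = 0"
  shows "d0 i = 0"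
proof -
  have c0z: "c0 p q = 0" if "b p q = 0" for p q
    using off_diagonal_tangent[of q p] c0_diag that by (cases "p = q") auto
  have bc: "c0 i l * b l j = 0" "b i l * c0 l j = 0" for l
    using path[of l] c0z by auto
  have "(d0 i + d0 j + d0 j) / 4 * T2 i j j + tan1 b d0 c0 T1 i j j + tan2 b d0 c0 diag3 i j j = 0"
    using ij by (intro second_order) (simp_all add: op_diag3)
  then show ?thesis
    using edge_relation[OF ij(1-3)] ij(1-3)
    by (simp add: T2_def tan1_def tan2_def op_T1 op_op_diag3 path bc b_diag c0_diag)
qed

text \<open>The second-order equation of type \<open>t i j k\<close>, for a source \<open>j\<close>
  of two edges whose ends are not joined in the orientation. Here
  \<open>d0 i = d0 k = 5 * d0 j\<close>, and what remains is a nonzero multiple of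
  \<open>d0 j\<close>.\<close>

lemma fork_vanish:
  assumes distinct: "i \<noteq> j" "j \<noteq> k" "i \<noteq> k"
    and b: "b i j = 1" "b k j = 1" "b j i = 0" "b j k = 0" "b i k = 0" "b k i = 0"
  shows "d0 j = 0"
proof -
  have c0z: "c0 i k = 0" "c0 k i = 0"
    using off_diagonal_tangent[of k i] off_diagonal_tangent[of i k] distinct b by auto
  have "(d0 i + d0 j + d0 k) / 4 * T2 i j k + tan1 b d0 c0 T1 i j k + tan2 b d0 c0 diag3 i j k = 0"
    using distinct by (intro second_order) (simp_all add: op_diag3)
  then show ?thesis
    using edge_relation[of j i] edge_relation[of j k] distinct b c0z
    by (simp add: T2_def tan1_def tan2_def op_T1 op_op_diag3)
qed

end

subsection \<open>Orienting the graph\<close>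

lemma rtrancl_leaves_subset:
  assumes "(v, w) \<in> R\<^sup>*" "v \<in> X" "w \<notin> X"
  shows "\<exists>x\<in>X. \<exists>y. y \<notin> X \<and> (x, y) \<in> R \<and> (v, y) \<in> R\<^sup>*"
  using assms
proof (induction rule: rtrancl_induct)
  case base then show ?case by blast
next
  case (step y z)
  then show ?case by (cases "y \<in> X") (auto intro: rtrancl_into_rtrancl)
qed

text \<open>
  \<open>\<delta>\<close> stands for the diagonal of a kernel vector of the limit equations.  Along an oriented edge it is
  multiplied by 5, so it vanishes on a whole component as soon as it vanishes somewhere, in particular
  if the component contains a triangle.  In a component in which every edge is reversible, a
  vertex with two neighbours is made the source of both edges.
\<close>

definition rigid_orientation :: "'n rel \<Rightarrow> 'n rel \<Rightarrow> bool" where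
  "rigid_orientation E F \<longleftrightarrow> F \<subseteq> E \<and> (\<forall>i j. (i, j) \<in> F \<longrightarrow> i \<noteq> j \<and> (j, i) \<notin> F) \<and>
    (\<forall>\<delta> :: 'n \<Rightarrow> real. (\<forall>i j. (i, j) \<in> F \<longrightarrow> \<delta> j = 5 * \<delta> i) \<longrightarrow>
      (\<forall>i j. (i, j) \<in> F \<longrightarrow> (j, i) \<notin> E \<longrightarrow> (\<forall>l. \<not> ((j, l) \<in> F \<and> (l, i) \<in> F)) \<longrightarrow> \<delta> i = 0) \<longrightarrow>
      (\<forall>i j k. (j, i) \<in> F \<longrightarrow> (j, k) \<in> F \<longrightarrow> i \<noteq> k \<longrightarrow> (i, k) \<notin> F \<longrightarrow> (k, i) \<notin> F \<longrightarrow> \<delta> j = 0) \<longrightarrow>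
      (\<forall>v. \<delta> v = 0))"

lemma rigid_orientation_zero:
  assumes "rigid_orientation E F"
    and "\<And>i j. (i, j) \<in> F \<Longrightarrow> \<delta> j = 5 * \<delta> i"
    and "\<And>i j. (i, j) \<in> F \<Longrightarrow> (j, i) \<notin> E \<Longrightarrow> (\<And>l. \<not> ((j, l) \<in> F \<and> (l, i) \<in> F)) \<Longrightarrow> \<delta> i = 0"
    and "\<And>i j k. (j, i) \<in> F \<Longrightarrow> (j, k) \<in> F \<Longrightarrow> i \<noteq> k \<Longrightarrow> (i, k) \<notin> F \<Longrightarrow> (k, i) \<notin> F \<Longrightarrow> \<delta> j = 0"
  shows "\<delta> v = (0 :: real)"
  using assms unfolding rigid_orientation_def by simp

text \<open>Reversible edges point to the larger \<open>key\<close>, the others keep their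
  direction. If \<open>\<delta>\<close> is nonzero on a component, all its edges must be reversible,
  so it has at least three nodes and a branching vertex; the vertex of least \<open>key\<close> is
  then the source of a fork.\<close>

lemma exists_rigid_orientation:
  fixes E :: "'n::finite rel"
  assumes loops: "all_self_loops E"
    and card2: "\<forall>C \<in> connected_components E. card C \<ge> 2"
    and cyc: "\<forall>C \<in> connected_components E. card C = 2 \<longrightarrow> \<not> is_two_cycle C (induced_edges E C)"
  shows "\<exists>F. rigid_orientation E F"
proof -
  define U where "U = E \<union> E\<inverse>"
  define branch where "branch x \<longleftrightarrow> (\<exists>y z. y \<noteq> z \<and> y \<noteq> x \<and> z \<noteq> x \<and> (x, y) \<in> U \<and> (x, z) \<in> U)" for x
  obtain g where g: "inj (g :: 'n \<Rightarrow> nat)" "\<And>x. g x < CARD('n)"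
  proof -
    obtain g where "bij_betw g (UNIV :: 'n set) {0..<CARD('n)}" using ex_bij_betw_finite_nat[of "UNIV :: 'n set"] by auto
    then show thesis by (intro that[of g]) (auto simp: bij_betw_def)
  qed
  \<comment> \<open>The offset \<open>CARD('n)\<close> places all branching vertices before the
    others.\<close>
  define key where "key x = (if branch x then g x else g x + CARD('n))" for x
  have key_inj: "key x = key y \<Longrightarrow> x = y" for x y
    using g(2)[of x] g(2)[of y] injD[OF g(1), of x y] by (auto simp: key_def split: if_splits)
  define F where "F = {(i, j) \<in> E. i \<noteq> j \<and> ((j, i) \<notin> E \<or> key i < key j)}"
  have total: "(i, j) \<in> F \<or> (j, i) \<in> F" if "(i, j) \<in> E" "i \<noteq> j" for i j
  proof -
    have "key i < key j \<or> key j < key i" using key_inj[of i j] that(2) by (meson linorder_neqE_nat)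
    then show ?thesis using that by (auto simp: F_def)
  qed
  have "F \<subseteq> E" "\<forall>i j. (i, j) \<in> F \<longrightarrow> i \<noteq> j \<and> (j, i) \<notin> F" by (auto simp: F_def)
  moreover have "\<forall>v. \<delta> v = 0"
    if five: "\<forall>i j. (i, j) \<in> F \<longrightarrow> \<delta> j = 5 * \<delta> i"
      and single: "\<forall>i j. (i, j) \<in> F \<longrightarrow> (j, i) \<notin> E \<longrightarrow> (\<forall>l. \<not> ((j, l) \<in> F \<and> (l, i) \<in> F)) \<longrightarrow> \<delta> i = 0"
      and fork: "\<forall>i j k. (j, i) \<in> F \<longrightarrow> (j, k) \<in> F \<longrightarrow> i \<noteq> k \<longrightarrow> (i, k) \<notin> F \<longrightarrow> (k, i) \<notin> F \<longrightarrow> \<delta> j = 0"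
    for \<delta> :: "'n \<Rightarrow> real"
  proof (rule ccontr)
      assume "\<not> (\<forall>v. \<delta> v = 0)"
      then obtain v where v: "\<delta> v \<noteq> 0" by blast
      define C where "C = {w. (v, w) \<in> U\<^sup>*}"
      have CC: "C \<in> connected_components E"
        by (auto simp: connected_components_def C_def U_def quotient_def Image_singleton)
      have vC: "v \<in> C" by (simp add: C_def)
      have U_step: "\<delta> i = 0 \<longleftrightarrow> \<delta> j = 0" if "(i, j) \<in> U" for i j
      proof (cases "i = j")
        case False
        then have "(i, j) \<in> F \<or> (j, i) \<in> F" using that total[of i j] total[of j i] by (auto simp: U_def)
        then show ?thesis using five by fastforce
      qed simp
      have nz: "\<delta> w \<noteq> 0" if "w \<in> C" for w
      proof -
        have "(v, w) \<in> U\<^sup>*" using that by (simp add: C_def)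
        then show ?thesis using v by (induction rule: rtrancl_induct) (auto simp: U_step)
      qed
      have closed: "j \<in> C" if "i \<in> C" "(i, j) \<in> U" for i j
        using that by (auto simp: C_def intro: rtrancl_into_rtrancl)
      have symE: "(j, i) \<in> E" if ij: "(i, j) \<in> E" "i \<in> C" for i j
      proof (rule ccontr)
        assume ji: "(j, i) \<notin> E"
        then have "i \<noteq> j" using loops by (auto simp: all_self_loops_def)
        then have F: "(i, j) \<in> F" using ij ji by (auto simp: F_def)
        have "\<not> ((j, l) \<in> F \<and> (l, i) \<in> F)" for l
        proof
          assume "(j, l) \<in> F \<and> (l, i) \<in> F"
          \<comment> \<open>Around an oriented triangle \<open>\<delta>\<close> would be multiplied
            by 125.\<close>
          then have "\<delta> i = 5 * (5 * (5 * \<delta> i))" using five F by metis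
          then show False using nz ij by simp
        qed
        then show False using single F ji nz ij by blast
      qed
      have symU: "(i, j) \<in> E \<and> (j, i) \<in> E" if "(i, j) \<in> U" "i \<in> C" for i j
        using that symE[of i j] symE[of j i] closed[of i j] by (auto simp: U_def)
      have leave: "\<exists>x\<in>X. \<exists>y\<in>C - X. (x, y) \<in> U" if "v \<in> X" "\<not> C \<subseteq> X" for X
      proof -
        obtain w where "(v, w) \<in> U\<^sup>*" "w \<notin> X" using \<open>\<not> C \<subseteq> X\<close> by (auto simp: C_def)
        from rtrancl_leaves_subset[OF this(1) \<open>v \<in> X\<close> this(2)] show ?thesis by (auto simp: C_def)
      qed
      have c2: "card C \<ge> 2" using card2 CC by blast
      then have "\<not> C \<subseteq> {v}" using card_mono[of "{v}" C] by auto
      with leave[of "{v}"] obtain y where y: "y \<in> C" "y \<noteq> v" "(v, y) \<in> U" by blast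
      \<comment> \<open>All edges of \<open>C\<close> being reversible, two nodes would form exactly
        the excluded two-cycle.\<close>
      have "card C \<noteq> 2"
      proof
        assume "card C = 2"
        then have "C = {v, y}" using vC y card_subset_eq[of C "{v, y}"] by auto
        moreover have "induced_edges E C = {(v, y), (y, v), (v, v), (y, y)}"
          using symU[OF y(3) vC] loops by (auto simp: induced_edges_def \<open>C = {v, y}\<close> all_self_loops_def)
        ultimately have "is_two_cycle C (induced_edges E C)"
          unfolding is_two_cycle_def using y(2) by blast
        then show False using cyc CC \<open>card C = 2\<close> by blast
      qed
      then have "\<not> C \<subseteq> {v, y}" using c2 card_mono[of "{v, y}" C] y(2) by auto
      with leave[of "{v, y}"] obtain x z where xz: "x \<in> {v, y}" "z \<in> C" "z \<noteq> v" "z \<noteq> y" "(x, z) \<in> U" by blast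
      have "branch x"
      proof (cases "x = v")
        case True then show ?thesis unfolding branch_def using y xz by blast
      next
        case False
        then have "x = y" using xz by simp
        moreover have "(y, v) \<in> U" using y(3) by (auto simp: U_def)
        ultimately show ?thesis unfolding branch_def using y xz by blast
      qed
      define m where "m = arg_min_on key C"
      have m: "m \<in> C" "\<And>w. w \<in> C \<Longrightarrow> key m \<le> key w"
        using vC by (auto simp: m_def intro!: arg_min_if_finite(1) arg_min_least)
      have "x \<in> C" using xz vC y by auto
      \<comment> \<open>Some vertex of \<open>C\<close> branches, so the least \<open>key\<close>
        lies below the offset and \<open>m\<close> branches too.\<close>
      then have "key m < CARD('n)" using m(2)[of x] \<open>branch x\<close> g(2)[of x] by (simp add: key_def)
      then have "branch m" by (auto simp: key_def split: if_splits)
      then obtain p q where pq: "p \<noteq> q" "p \<noteq> m" "q \<noteq> m" "(m, p) \<in> U" "(m, q) \<in> U"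
        unfolding branch_def by blast
      have Fm: "(m, w) \<in> F" if "w \<noteq> m" "(m, w) \<in> U" for w
      proof -
        have "key m \<noteq> key w" using key_inj[of m w] that by blast
        then have "key m < key w" using m(2)[of w] closed[OF m(1) that(2)] by simp
        then show ?thesis using symU[OF that(2) m(1)] that by (auto simp: F_def)
      qed
      have "\<delta> p = \<delta> q" using five Fm[of p] Fm[of q] pq by simp
      have "\<delta> p \<noteq> 0" "\<delta> q \<noteq> 0" using nz closed[OF m(1)] pq by auto
      \<comment> \<open>Both values equal \<open>5 * \<delta> m\<close>, whereas an oriented edge
        between \<open>p\<close> and \<open>q\<close> would force a ratio of 5.\<close>
      have "(p, q) \<notin> F" "(q, p) \<notin> F"
        using five \<open>\<delta> p = \<delta> q\<close> \<open>\<delta> p \<noteq> 0\<close> by auto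
      then have "\<delta> m = 0" using fork Fm[of p] Fm[of q] pq by blast
      then show False using nz m(1) by blast
    qed
  ultimately show ?thesis unfolding rigid_orientation_def by blast
qed

subsection \<open>The cumulants as rational functions\<close>

lemma real_polynomial_function_det:
  fixes M :: "'a::real_normed_vector \<Rightarrow> real ^ 'm ^ 'm"
  assumes "\<And>i j. real_polynomial_function (\<lambda>x. M x $ i $ j)"
  shows "real_polynomial_function (\<lambda>x. det (M x))"
  unfolding det_def
  by (intro real_polynomial_function_sum real_polynomial_function.intros(2,4) real_polynomial_function_prod assms)
     (auto intro: finite_permutations)

lemma polynomial_function_vec:
  fixes f :: "'a::real_normed_vector \<Rightarrow> 'b::euclidean_space ^ 'm"
  assumes "\<And>i. polynomial_function (\<lambda>x. f x $ i)"
  shows "polynomial_function f"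
  using assms unfolding polynomial_function_iff_Basis_inner
  by (auto simp: Basis_vec_def inner_axis)

lemma polynomial_function_components:
  fixes f :: "'a::real_normed_vector \<Rightarrow> 'b::euclidean_space \<times> 'c::euclidean_space"
  assumes "polynomial_function (\<lambda>x. fst (f x))" "polynomial_function (\<lambda>x. snd (f x))"
  shows "polynomial_function f"
  using assms unfolding polynomial_function_iff_Basis_inner
  by (auto simp: Basis_prod_def inner_prod_def)

lemma param_coordinates_polynomial:
  "real_polynomial_function (\<lambda>x :: 'n::finite param. fst x $ i $ j)"
  "real_polynomial_function (\<lambda>x :: 'n param. fst (snd x) $ i)"
  "real_polynomial_function (\<lambda>x :: 'n param. snd (snd x) $ i)"
  by (intro real_polynomial_function.intros(1) bounded_linear_compose[OF bounded_linear_vec_nth]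
      bounded_linear_fst bounded_linear_compose[OF bounded_linear_fst] bounded_linear_compose[OF bounded_linear_snd]
      bounded_linear_snd)+

text \<open>Cramer's rule for both cumulants over the common denominator formed by the two
  determinants; each numerator is multiplied by the determinant of the other system.\<close>

lemma cumulant_map_rational:
  obtains D and N :: "'n::finite param \<Rightarrow> (real ^ 'n ^ 'n) \<times> (real ^ 'n ^ 'n ^ 'n)"
  where "real_polynomial_function D" "polynomial_function N"
    "\<And>\<theta>. schur_stable (fst \<theta>) \<Longrightarrow> D \<theta> \<noteq> 0 \<and> cumulant_map \<theta> = N \<theta> /\<^sub>R D \<theta>"
proof -
  let ?K2 = "\<lambda>\<theta> :: 'n param. kron2 (fst \<theta>)"
  let ?K3 = "\<lambda>\<theta> :: 'n param. kron3 (fst \<theta>)"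
  let ?b2 = "\<lambda>\<theta> :: 'n param. \<chi> r. diag_matrix (fst (snd \<theta>)) $ fst r $ snd r"
  let ?b3 = "\<lambda>\<theta> :: 'n param. \<chi> r. diag_tensor (snd (snd \<theta>)) $ fst r $ fst (snd r) $ snd (snd r)"
  let ?D2 = "\<lambda>\<theta>. det (mat 1 - ?K2 \<theta>)"
  let ?D3 = "\<lambda>\<theta>. det (mat 1 - ?K3 \<theta>)"
  let ?C2 = "\<lambda>k \<theta>. det (\<chi> i j. if j = k then ?b2 \<theta> $ i else (mat 1 - ?K2 \<theta>) $ i $ j)"
  let ?C3 = "\<lambda>k \<theta>. det (\<chi> i j. if j = k then ?b3 \<theta> $ i else (mat 1 - ?K3 \<theta>) $ i $ j)"
  have K2: "real_polynomial_function (\<lambda>\<theta>. (mat 1 - ?K2 \<theta>) $ i $ j)" for i j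
    by (simp add: kron2_def kronecker_def mat_def)
       (intro conjI impI real_polynomial_function_diff real_polynomial_function_minus
         real_polynomial_function.intros(2,4) param_coordinates_polynomial)
  have K3: "real_polynomial_function (\<lambda>\<theta>. (mat 1 - ?K3 \<theta>) $ i $ j)" for i j
    by (simp add: kron3_def kronecker_def mat_def)
       (intro conjI impI real_polynomial_function_diff real_polynomial_function_minus
         real_polynomial_function.intros(2,4) param_coordinates_polynomial)
  have b2: "real_polynomial_function (\<lambda>\<theta>. ?b2 \<theta> $ i)" for i
    by (cases "fst i = snd i") (auto simp: diag_matrix_def intro: param_coordinates_polynomial real_polynomial_function.intros(2))
  have b3: "real_polynomial_function (\<lambda>\<theta>. ?b3 \<theta> $ i)" for i
    by (cases "fst i = fst (snd i) \<and> fst (snd i) = snd (snd i)")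
       (auto simp: diag_tensor_def intro: param_coordinates_polynomial real_polynomial_function.intros(2))
  have D: "real_polynomial_function ?D2" "real_polynomial_function ?D3"
    by (intro real_polynomial_function_det K2 K3)+
  have C2: "real_polynomial_function (?C2 k)" for k
  proof (rule real_polynomial_function_det)
    fix i j show "real_polynomial_function (\<lambda>\<theta>. (\<chi> i j. if j = k then ?b2 \<theta> $ i else (mat 1 - ?K2 \<theta>) $ i $ j) $ i $ j)"
      using b2[of i] K2[of i j] by (cases "j = k") auto
  qed
  have C3: "real_polynomial_function (?C3 k)" for k
  proof (rule real_polynomial_function_det)
    fix i j show "real_polynomial_function (\<lambda>\<theta>. (\<chi> i j. if j = k then ?b3 \<theta> $ i else (mat 1 - ?K3 \<theta>) $ i $ j) $ i $ j)"
      using b3[of i] K3[of i j] by (cases "j = k") auto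
  qed
  let ?N = "\<lambda>\<theta>. ((\<chi> i j. ?D3 \<theta> * ?C2 (i, j) \<theta>) :: real ^ 'n ^ 'n,
      (\<chi> i j k. ?D2 \<theta> * ?C3 (i, j, k) \<theta>) :: real ^ 'n ^ 'n ^ 'n)"
  have "polynomial_function ?N"
  proof (intro polynomial_function_components polynomial_function_vec)
    show "polynomial_function (\<lambda>x. fst (?N x) $ i $ j)" for i j
      using real_polynomial_function.intros(4)[OF D(2) C2[of "(i, j)"]]
      by (simp add: real_polynomial_function_eq)
    show "polynomial_function (\<lambda>x. snd (?N x) $ i $ j $ k)" for i j k
      using real_polynomial_function.intros(4)[OF D(1) C3[of "(i, j, k)"]]
      by (simp add: real_polynomial_function_eq)
  qed
  moreover have "?D2 \<theta> * ?D3 \<theta> \<noteq> 0 \<and> cumulant_map \<theta> = ?N \<theta> /\<^sub>R (?D2 \<theta> * ?D3 \<theta>)"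
    if "schur_stable (fst \<theta>)" for \<theta>
  proof -
    obtain A w2 w3 where \<theta>: "\<theta> = (A, w2, w3)" by (cases \<theta>) auto
    have nz: "?D2 \<theta> \<noteq> 0" "?D3 \<theta> \<noteq> 0" using det_kron_nonzero[OF that] by auto
    then have "cumulant_map \<theta> = ?N \<theta> /\<^sub>R (?D2 \<theta> * ?D3 \<theta>)"
      unfolding cumulant_map_def \<theta> fst_conv snd_conv
      by (simp add: second_cumulant_solution(1) third_cumulant_solution(1) stein_solution_def vec_eq_iff field_simps)
    then show ?thesis using nz by simp
  qed
  ultimately show thesis
    using that[of "\<lambda>\<theta>. ?D2 \<theta> * ?D3 \<theta>" ?N] real_polynomial_function.intros(4)[OF D] by blast
qed

text \<open>Compare both sides of the eigenvector equation in a coordinate where the eigenvector has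
  largest modulus.\<close>

lemma row_sum_schur_stable:
  fixes A :: "real ^ 'n ^ 'n"
  assumes "\<And>i. (\<Sum>j\<in>UNIV. \<bar>A $ i $ j\<bar>) < 1"
  shows "schur_stable A"
  unfolding schur_stable_def complex_eigenvalue_def
proof clarify
  fix z and v :: "complex ^ 'n"
  assume v: "v \<noteq> 0" "map_matrix complex_of_real A *v v = z *s v"
  have "Max (range (\<lambda>i. norm (v $ i))) \<in> range (\<lambda>i. norm (v $ i))" by (rule Max_in) auto
  then obtain i where "norm (v $ i) = Max (range (\<lambda>i. norm (v $ i)))" by force
  then have i: "norm (v $ j) \<le> norm (v $ i)" for j by simp
  obtain j where "v $ j \<noteq> 0" using v(1) by (auto simp: vec_eq_iff)
  then have pos: "norm (v $ i) > 0" using i[of j] by (meson less_le_trans zero_less_norm_iff)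
  have "norm z * norm (v $ i) = norm ((map_matrix complex_of_real A *v v) $ i)"
    by (simp add: v(2) norm_mult)
  also have "\<dots> \<le> (\<Sum>j\<in>UNIV. norm (complex_of_real (A $ i $ j) * v $ j))"
    unfolding matrix_vector_mult_def map_matrix_def by (simp add: norm_sum)
  also have "\<dots> \<le> (\<Sum>j\<in>UNIV. \<bar>A $ i $ j\<bar> * norm (v $ i))"
    by (intro sum_mono) (simp add: norm_mult mult_left_mono i)
  also have "\<dots> = (\<Sum>j\<in>UNIV. \<bar>A $ i $ j\<bar>) * norm (v $ i)" by (simp add: sum_distrib_right)
  also have "\<dots> < 1 * norm (v $ i)" using assms[of i] pos by (intro mult_strict_right_mono)
  finally show "norm z < 1" using pos by simp
qed

subsection \<open>Kernel vectors of the Jacobian\<close>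

text \<open>The derivative of the cumulant equations in direction \<open>H\<close>, with the
  cumulants held fixed. Only entries off the diagonal are kept, because the diagonal ones also
  involve the variation of the noise parameters.\<close>

definition cumulant_kernel :: "real ^ 'n::finite ^ 'n \<Rightarrow> real ^ 'n ^ 'n \<Rightarrow> real ^ 'n ^ 'n ^ 'n \<Rightarrow> real ^ 'n ^ 'n \<Rightarrow> bool" where
  "cumulant_kernel A S T H \<longleftrightarrow>
    (\<forall>i j. i \<noteq> j \<longrightarrow>
        (\<Sum>l\<in>UNIV. \<Sum>m\<in>UNIV. H $ i $ l * A $ j $ m * S $ l $ m)
      + (\<Sum>l\<in>UNIV. \<Sum>m\<in>UNIV. A $ i $ l * H $ j $ m * S $ l $ m) = 0) \<and>
    (\<forall>i j k. \<not> (i = j \<and> j = k) \<longrightarrow>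
        (\<Sum>l\<in>UNIV. \<Sum>m\<in>UNIV. \<Sum>q\<in>UNIV. H $ i $ l * A $ j $ m * A $ k $ q * T $ l $ m $ q)
      + (\<Sum>l\<in>UNIV. \<Sum>m\<in>UNIV. \<Sum>q\<in>UNIV. A $ i $ l * H $ j $ m * A $ k $ q * T $ l $ m $ q)
      + (\<Sum>l\<in>UNIV. \<Sum>m\<in>UNIV. \<Sum>q\<in>UNIV. A $ i $ l * A $ j $ m * H $ k $ q * T $ l $ m $ q) = 0)"

lemma cumulant_kernel_scale:
  assumes "cumulant_kernel A S T H"
  shows "cumulant_kernel A S T (c *\<^sub>R H)"
proof -
  have pull: "(\<Sum>l\<in>UNIV. c * f l) = c * (\<Sum>l\<in>UNIV. f l)" for f :: "'a \<Rightarrow> real"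
    by (simp add: sum_distrib_left)
  show ?thesis
    using assms unfolding cumulant_kernel_def
    by (simp only: vector_scaleR_component real_scaleR_def
        mult.assoc mult.left_commute[of _ c] pull distrib_left[symmetric]) auto
qed

lemma second_cumulant_entry:
  assumes "schur_stable A"
  shows "second_cumulant A w $ i $ j = (\<Sum>l\<in>UNIV. \<Sum>m\<in>UNIV. A $ i $ l * A $ j $ m * second_cumulant A w $ l $ m)
    + diag_matrix w $ i $ j"
  unfolding matrix_congruence_entry[symmetric] vector_add_component[symmetric]
  using second_cumulant_solution(2)[OF det_kron_nonzero(1)[OF assms], of w] by (rule arg_cong)

lemma third_cumulant_entry:
  assumes "schur_stable A"
  shows "third_cumulant A w $ i $ j $ k = (\<Sum>l\<in>UNIV. \<Sum>m\<in>UNIV. \<Sum>n\<in>UNIV.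
           A $ i $ l * A $ j $ m * A $ k $ n * third_cumulant A w $ l $ m $ n) + diag_tensor w $ i $ j $ k"
  by (rule third_cumulant_solution(2)[OF det_kron_nonzero(2)[OF assms]])

section \<open>Differentiating the cumulant equations along a line\<close>

lemma has_field_derivative_affine: "((\<lambda>t. a + t * h) has_real_derivative h) (at t)" for a h t :: real
  by (auto intro!: derivative_eq_intros)

text \<open>Differentiate the fixed-point equation at \<open>t = 0\<close>: as \<open>s\<close> is
  stationary there, only the derivatives of the matrix factors and of the noise term
  survive.\<close>

lemma second_kernel_equation:
  fixes a h :: "'n::finite \<Rightarrow> 'n \<Rightarrow> real"
  assumes s: "\<And>l m. ((\<lambda>t. s t l m) has_real_derivative 0) (at 0)"
    and eq: "\<forall>\<^sub>F t in nhds 0. s t i j = (\<Sum>l\<in>UNIV. \<Sum>m\<in>UNIV. (a i l + t * h i l) * (a j m + t * h j m) * s t l m) + (w + t * v)"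
  shows "(\<Sum>l\<in>UNIV. \<Sum>m\<in>UNIV. h i l * a j m * s 0 l m) + (\<Sum>l\<in>UNIV. \<Sum>m\<in>UNIV. a i l * h j m * s 0 l m) + v = 0"
proof -
  have "((\<lambda>t. (a i l + t * h i l) * (a j m + t * h j m) * s t l m) has_real_derivative
      (h i l * a j m + a i l * h j m) * s 0 l m) (at 0)" for l m
    using DERIV_mult[OF DERIV_mult[OF has_field_derivative_affine[of "a i l" "h i l" 0] has_field_derivative_affine[of "a j m" "h j m" 0]] s[of l m]]
    by (simp add: algebra_simps)
  then have "((\<lambda>t. (\<Sum>l\<in>UNIV. \<Sum>m\<in>UNIV. (a i l + t * h i l) * (a j m + t * h j m) * s t l m) + (w + t * v)) has_real_derivative
      (\<Sum>l\<in>UNIV. \<Sum>m\<in>UNIV. (h i l * a j m + a i l * h j m) * s 0 l m) + v) (at 0)"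
    by (intro DERIV_add DERIV_sum has_field_derivative_affine)
  then have "((\<lambda>t. s t i j) has_real_derivative
      (\<Sum>l\<in>UNIV. \<Sum>m\<in>UNIV. (h i l * a j m + a i l * h j m) * s 0 l m) + v) (at 0)"
    by (subst DERIV_cong_ev[OF refl eq refl])
  from DERIV_unique[OF this s[of i j]] show ?thesis
    by (simp add: distrib_right sum.distrib)
qed

lemma third_kernel_equation:
  fixes a h :: "'n::finite \<Rightarrow> 'n \<Rightarrow> real"
  assumes s: "\<And>l m q. ((\<lambda>t. s t l m q) has_real_derivative 0) (at 0)"
    and eq: "\<forall>\<^sub>F t in nhds 0. s t i j k = (\<Sum>l\<in>UNIV. \<Sum>m\<in>UNIV. \<Sum>q\<in>UNIV.
      (a i l + t * h i l) * (a j m + t * h j m) * (a k q + t * h k q) * s t l m q) + (w + t * v)"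
  shows "(\<Sum>l\<in>UNIV. \<Sum>m\<in>UNIV. \<Sum>q\<in>UNIV. h i l * a j m * a k q * s 0 l m q)
    + (\<Sum>l\<in>UNIV. \<Sum>m\<in>UNIV. \<Sum>q\<in>UNIV. a i l * h j m * a k q * s 0 l m q)
    + (\<Sum>l\<in>UNIV. \<Sum>m\<in>UNIV. \<Sum>q\<in>UNIV. a i l * a j m * h k q * s 0 l m q) + v = 0"
proof -
  have "((\<lambda>t. (a i l + t * h i l) * (a j m + t * h j m) * (a k q + t * h k q) * s t l m q) has_real_derivative
      (h i l * a j m * a k q + a i l * h j m * a k q + a i l * a j m * h k q) * s 0 l m q) (at 0)" for l m q
    using DERIV_mult[OF DERIV_mult[OF DERIV_mult[OF has_field_derivative_affine[of "a i l" "h i l" 0]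
      has_field_derivative_affine[of "a j m" "h j m" 0]] has_field_derivative_affine[of "a k q" "h k q" 0]] s[of l m q]]
    by (simp add: algebra_simps)
  then have "((\<lambda>t. (\<Sum>l\<in>UNIV. \<Sum>m\<in>UNIV. \<Sum>q\<in>UNIV.
      (a i l + t * h i l) * (a j m + t * h j m) * (a k q + t * h k q) * s t l m q) + (w + t * v)) has_real_derivative
      (\<Sum>l\<in>UNIV. \<Sum>m\<in>UNIV. \<Sum>q\<in>UNIV. (h i l * a j m * a k q + a i l * h j m * a k q + a i l * a j m * h k q) * s 0 l m q) + v) (at 0)"
    by (intro DERIV_add DERIV_sum has_field_derivative_affine)
  then have "((\<lambda>t. s t i j k) has_real_derivative
      (\<Sum>l\<in>UNIV. \<Sum>m\<in>UNIV. \<Sum>q\<in>UNIV. (h i l * a j m * a k q + a i l * h j m * a k q + a i l * a j m * h k q) * s 0 l m q) + v) (at 0)"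
    by (subst DERIV_cong_ev[OF refl eq refl])
  from DERIV_unique[OF this s[of i j k]] show ?thesis
    by (simp add: distrib_right sum.distrib)
qed

text \<open>The noise values are \<open>1 - 1/4\<close> and \<open>1 - 1/8\<close>, so that at
  \<open>e = 0\<close> both cumulants are identity tensors.\<close>

definition degenerate_param :: "'n rel \<Rightarrow> real \<Rightarrow> 'n::finite param" where
  "degenerate_param F e = ((\<chi> i j. (if i = j then 1/2 else 0) + e * (if (j, i) \<in> F then 1 else 0)), (\<chi> i. 3/4), (\<chi> i. 7/8))"

lemma degenerate_param_row_sum:
  assumes "\<bar>e\<bar> \<le> 1 / (4 * real CARD('n::finite))"
  shows "(\<Sum>j\<in>UNIV. \<bar>fst (degenerate_param F e) $ i $ (j :: 'n)\<bar>) < 1"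
proof -
  have "(\<Sum>j\<in>UNIV. \<bar>fst (degenerate_param F e) $ i $ j\<bar>) \<le> (\<Sum>j\<in>UNIV. (if i = j then 1/2 else 0) + \<bar>e\<bar>)"
    by (intro sum_mono) (auto simp: degenerate_param_def)
  also have "\<dots> = 1/2 + real CARD('n) * \<bar>e\<bar>" by (simp add: sum.distrib)
  also have "\<dots> \<le> 1/2 + real CARD('n) * (1 / (4 * real CARD('n)))"
    using assms by (intro add_left_mono mult_left_mono) auto
  also have "\<dots> < 1" by simp
  finally show ?thesis .
qed

lemma cumulants_at_diagonal:
  "second_cumulant (fst (degenerate_param F 0)) (\<chi> i. 3/4) $ i $ j = (if i = j then 1 else 0)" (is "?S i j = _")
  "third_cumulant (fst (degenerate_param F 0)) (\<chi> i. 7/8) $ i $ j $ k = diag3 i j k" (is "?T i j k = _")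
proof -
  have st: "schur_stable (fst (degenerate_param F 0))"
    by (intro row_sum_schur_stable degenerate_param_row_sum) simp
  have "?S i j = 1/2 * (1/2) * ?S i j + diag_matrix (\<chi> i. 3/4) $ i $ j"
    by (subst second_cumulant_entry[OF st])
       (use double_sum_expand[of i "1/2" 0 "\<lambda>_ _. 0" j "1/2" "\<lambda>_ _. 0" "?S"] in \<open>simp add: degenerate_param_def\<close>)
  then show "?S i j = (if i = j then 1 else 0)" by (auto simp: diag_matrix_def)
  have "?T i j k = 1/2 * (1/2) * (1/2) * ?T i j k + diag_tensor (\<chi> i. 7/8) $ i $ j $ k"
    by (subst third_cumulant_entry[OF st])
       (use triple_sum_expand[of i "1/2" 0 "\<lambda>_ _. 0" j "1/2" "\<lambda>_ _. 0" k "1/2" "\<lambda>_ _. 0" "?T"] in \<open>simp add: degenerate_param_def\<close>)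
  then show "?T i j k = diag3 i j k" by (auto simp: diag_tensor_def diag3_def)
qed

text \<open>Stability keeps the denominator nonzero at the limit parameter, so the rational
  expression for the cumulants is continuous there.\<close>

lemma degenerate_cumulants_tendsto:
  fixes F :: "'n::finite rel"
  assumes e: "e \<longlonglongrightarrow> 0" "\<And>n. \<bar>e n\<bar> \<le> 1 / (4 * real CARD('n))"
  shows "(\<lambda>n. second_cumulant (fst (degenerate_param F (e n))) (\<chi> i. 3/4) $ i $ j) \<longlonglongrightarrow> (if i = j then 1 else 0)"
    and "(\<lambda>n. third_cumulant (fst (degenerate_param F (e n))) (\<chi> i. 7/8) $ i $ j $ k) \<longlonglongrightarrow> diag3 i j k"
proof -
  obtain D and N :: "'n param \<Rightarrow> (real ^ 'n ^ 'n) \<times> (real ^ 'n ^ 'n ^ 'n)" where DN: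
    "real_polynomial_function D" "polynomial_function N"
    "\<And>\<theta>. schur_stable (fst \<theta>) \<Longrightarrow> D \<theta> \<noteq> 0 \<and> cumulant_map \<theta> = N \<theta> /\<^sub>R D \<theta>"
    by (rule cumulant_map_rational) (rule that)
  have st: "schur_stable (fst (degenerate_param F x))" if "\<bar>x\<bar> \<le> 1 / (4 * real CARD('n))" for x
    using that by (intro row_sum_schur_stable degenerate_param_row_sum)
  have st0: "schur_stable (fst (degenerate_param F 0))" by (rule st) simp
  have dl: "(\<lambda>n. degenerate_param F (e n)) \<longlonglongrightarrow> degenerate_param F 0"
    unfolding degenerate_param_def
    by (intro tendsto_Pair tendsto_const tendsto_vec_lambda tendsto_add tendsto_mult e(1))
  have "isCont D (degenerate_param F 0)" "isCont N (degenerate_param F 0)"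
    using DN(1,2) continuous_on_polymonial_function[of D UNIV] continuous_on_polymonial_function[of N UNIV]
    by (auto simp: real_polynomial_function_eq continuous_on_eq_continuous_at simp del: split_paired_All)
  then have "(\<lambda>n. D (degenerate_param F (e n))) \<longlonglongrightarrow> D (degenerate_param F 0)"
    "(\<lambda>n. N (degenerate_param F (e n))) \<longlonglongrightarrow> N (degenerate_param F 0)"
    using dl isCont_tendsto_compose by blast+
  then have "(\<lambda>n. N (degenerate_param F (e n)) /\<^sub>R D (degenerate_param F (e n)))
      \<longlonglongrightarrow> N (degenerate_param F 0) /\<^sub>R D (degenerate_param F 0)"
    using DN(3)[OF st0] by (intro tendsto_intros) auto
  then have lim: "(\<lambda>n. cumulant_map (degenerate_param F (e n))) \<longlonglongrightarrow> cumulant_map (degenerate_param F 0)"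
    using DN(3)[OF st0] DN(3)[OF st[OF e(2)]] by simp
  have cm: "cumulant_map (degenerate_param F x) = (second_cumulant (fst (degenerate_param F x)) (\<chi> i. 3/4),
     third_cumulant (fst (degenerate_param F x)) (\<chi> i. 7/8))" for x
    by (simp add: cumulant_map_def degenerate_param_def)
  show "(\<lambda>n. second_cumulant (fst (degenerate_param F (e n))) (\<chi> i. 3/4) $ i $ j) \<longlonglongrightarrow> (if i = j then 1 else 0)"
    using tendsto_vec_nth[OF tendsto_vec_nth[OF tendsto_fst[OF lim], of i], of j]
    by (simp only: cm fst_conv cumulants_at_diagonal)
  show "(\<lambda>n. third_cumulant (fst (degenerate_param F (e n))) (\<chi> i. 7/8) $ i $ j $ k) \<longlonglongrightarrow> diag3 i j k"
    using tendsto_vec_nth[OF tendsto_vec_nth[OF tendsto_vec_nth[OF tendsto_snd[OF lim], of i], of j], of k]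
    by (simp only: cm snd_conv cumulants_at_diagonal)
qed

lemma exists_immersion_point:
  fixes E F :: "'n::finite rel"
  assumes rigid: "rigid_orientation E F"
  shows "\<exists>e. \<bar>e\<bar> \<le> 1 / (4 * real CARD('n)) \<and> (\<forall>H \<in> graph_matrices E.
    cumulant_kernel (fst (degenerate_param F e)) (second_cumulant (fst (degenerate_param F e)) (\<chi> i. 3/4))
      (third_cumulant (fst (degenerate_param F e)) (\<chi> i. 7/8)) H \<longrightarrow> H = 0)"
proof (rule ccontr)
  let ?A = "\<lambda>e. fst (degenerate_param F e)"
  let ?S = "\<lambda>e. second_cumulant (?A e) (\<chi> i. 3/4)"
  let ?T = "\<lambda>e. third_cumulant (?A e) (\<chi> i. 7/8)"
  assume neg: "\<not> ?thesis"
  have anti: "i \<noteq> j \<and> (j, i) \<notin> F" if "(i, j) \<in> F" for i j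
    using rigid that by (auto simp: rigid_orientation_def)
  define e where "e n = 1 / (4 * real CARD('n)) / real (Suc n)" for n
  have e_pos: "e n > 0" for n by (simp add: e_def)
  have e_le: "\<bar>e n\<bar> \<le> 1 / (4 * real CARD('n))" for n by (simp add: e_def divide_le_eq)
  have e_lim: "e \<longlonglongrightarrow> 0"
    unfolding e_def by (rule tendsto_divide_0[OF tendsto_const]) (rule filterlim_at_top_imp_at_infinity[OF filterlim_compose[OF filterlim_real_sequentially filterlim_Suc]])
  have "\<exists>H. H \<in> graph_matrices E \<and> H \<noteq> 0 \<and> cumulant_kernel (?A (e n)) (?S (e n)) (?T (e n)) H" for n
    using neg e_le[of n] by blast
  then have "\<exists>H. \<forall>n. H n \<in> graph_matrices E \<and> H n \<noteq> 0 \<and> cumulant_kernel (?A (e n)) (?S (e n)) (?T (e n)) (H n)"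
    by (intro choice allI)
  then obtain H where H: "\<forall>n. H n \<in> graph_matrices E \<and> H n \<noteq> 0 \<and> cumulant_kernel (?A (e n)) (?S (e n)) (?T (e n)) (H n)" ..
  \<comment> \<open>Dividing the off-diagonal part by \<open>e n\<close> puts it on the same scale
    as the diagonal part; after normalisation the kernel vector has the form required of
    \<open>h\<close> in \<open>degeneration\<close>.\<close>
  define U where "U n = (\<chi> i j. if i = j then H n $ i $ j else H n $ i $ j / e n)" for n
  have U0: "U n \<noteq> 0" for n
  proof
    assume "U n = 0"
    then have Uz: "U n $ i $ j = 0" for i j by simp
    have "H n $ i $ j = 0" for i j
      using Uz[of i j] e_pos[of n] by (auto simp: U_def split: if_splits)
    then have "H n = 0" by (simp add: vec_eq_iff)
    with H show False by blast
  qed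
  define M where "M n = U n /\<^sub>R norm (U n)" for n
  have nM: "M n \<in> sphere 0 1" for n using U0 by (simp add: M_def)
  have "compact (sphere (0 :: real ^ 'n ^ 'n) 1)" by simp
  then obtain M0 r where M0: "M0 \<in> sphere 0 1" "strict_mono (r :: nat \<Rightarrow> nat)" "(M \<circ> r) \<longlonglongrightarrow> M0"
    using nM unfolding compact_def by (metis (no_types, lifting))
  have M_lim: "(\<lambda>n. M (r n) $ i $ j) \<longlonglongrightarrow> M0 $ i $ j" for i j
    using M0(3) by (intro tendsto_vec_nth) (simp add: o_def)
  have ME: "M n $ j $ i = 0" if "(i, j) \<notin> E" for i j n
  proof -
    have "H n $ j $ i = 0" using H that by (simp add: graph_matrices_def)
    then show ?thesis by (cases "i = j") (auto simp: M_def U_def)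
  qed
  have er_lim: "(\<lambda>n. e (r n)) \<longlonglongrightarrow> 0"
    using LIMSEQ_subseq_LIMSEQ[OF e_lim M0(2)] by (simp add: o_def)
  have st: "schur_stable (?A (e n))" for n
    by (intro row_sum_schur_stable degenerate_param_row_sum e_le)
  let ?b = "\<lambda>i j. if (j, i) \<in> F then 1 else (0 :: real)"
  let ?c = "\<lambda>n i j. if i = j then 0 else M (r n) $ i $ j"
  have K: "cumulant_kernel (?A (e n)) (?S (e n)) (?T (e n)) (H n /\<^sub>R norm (U n))" for n
    using H by (intro cumulant_kernel_scale) simp
  have HM: "(H n /\<^sub>R norm (U n)) $ i $ j = (if i = j then M n $ i $ i else 0) + e n * (if i = j then 0 else M n $ i $ j)" for n i j
    using e_pos[of n] by (simp add: M_def U_def)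
  interpret degeneration ?b "\<lambda>n. e (r n)" "\<lambda>n i. M (r n) $ i $ i" ?c "\<lambda>i. M0 $ i $ i"
    "\<lambda>i j. if i = j then 0 else M0 $ i $ j"
    "\<lambda>n i j. ?S (e (r n)) $ i $ j" "\<lambda>n i j k. ?T (e (r n)) $ i $ j $ k"
    "\<lambda>n i j. ?A (e (r n)) $ i $ j" "\<lambda>n i j. (H (r n) /\<^sub>R norm (U (r n))) $ i $ j"
  proof (unfold_locales, goal_cases)
    case (1 n i j) show ?case by (simp add: degenerate_param_def)
  next
    case (2 n i j) show ?case by (rule HM)
  next
    case (3 i) show ?case using anti by auto
  next
    case (4 n i) show ?case by simp
  next
    case (5 n) show ?case using e_pos[of "r n"] by simp
  next
    case 6 show ?case by (rule er_lim)
  next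
    case (7 i) show ?case by (rule M_lim)
  next
    case (8 i j) show ?case using M_lim[of i j] by auto
  next
    case (9 i j) show ?case by (rule degenerate_cumulants_tendsto(1)[OF er_lim e_le])
  next
    case (10 i j k) show ?case by (rule degenerate_cumulants_tendsto(2)[OF er_lim e_le])
  next
    case (11 n i j)
    then show ?case by (subst second_cumulant_entry[OF st]) (simp add: diag_matrix_def)
  next
    case (12 n i j k)
    show ?case by (subst third_cumulant_entry[OF st]) (simp add: diag_tensor_def diag3_def)
  next
    case (13 n i j)
    then show ?case using K[of "r n"] unfolding cumulant_kernel_def by blast
  next
    case (14 n i j k)
    then show ?case using K[of "r n"] unfolding cumulant_kernel_def by blast
  qed
  have d0: "M0 $ v $ v = 0" for v
  proof (rule rigid_orientation_zero[OF rigid, of "\<lambda>v. M0 $ v $ v"])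
    fix i j assume ij: "(i, j) \<in> F"
    show "M0 $ j $ j = 5 * M0 $ i $ i"
      using edge_relation(1)[of i j] ij anti by auto
  next
    fix i j assume ij: "(i, j) \<in> F" "(j, i) \<notin> E" and tri: "\<And>l. \<not> ((j, l) \<in> F \<and> (l, i) \<in> F)"
    show "M0 $ i $ i = 0"
      \<comment> \<open>Since the reverse edge is absent from \<open>E\<close>, its entry vanishes
        for every \<open>n\<close> and not only in the limit; this is the fact
        \<open>ME\<close>.\<close>
      using single_edge_vanish[of i j] ij anti ME[OF ij(2)] tri by auto
  next
    fix i j k assume "(j, i) \<in> F" "(j, k) \<in> F" "i \<noteq> k" "(i, k) \<notin> F" "(k, i) \<notin> F"
    then show "M0 $ j $ j = 0"
      using fork_vanish[of i j k] anti by auto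
  qed
  have "M0 $ i $ j = 0" for i j
    using off_diagonal_tangent[of j i] d0 by (cases "i = j") auto
  then have "M0 = 0" by (simp add: vec_eq_iff)
  then show False using M0(1) by simp
qed

section \<open>Projection onto the graph pattern, and an open set of stable parameters\<close>

definition mask :: "'n rel \<Rightarrow> 'n::finite param \<Rightarrow> 'n param" where
  "mask E x = ((\<chi> j i. if (i, j) \<in> E then fst x $ j $ i else 0), snd x)"

lemma linear_mask: "linear (mask E)"
  by (rule linearI) (auto simp: mask_def vec_eq_iff)

lemma mask_eq_iff: "mask E x = x \<longleftrightarrow> fst x \<in> graph_matrices E"
  by (cases x) (auto simp: mask_def graph_matrices_def vec_eq_iff)

lemma mask_idem: "mask E (mask E x) = mask E x"
  by (simp add: mask_def vec_eq_iff)

text \<open>The matrices here need not respect the graph, which keeps the set open in the whole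
  space. Row sums are used instead of stability because setting entries to zero cannot increase
  them. Positive third-order noise selects a simple open part of the nonzero vectors.\<close>

definition contractive_params :: "'n::finite param set" where
  "contractive_params = {x. (\<forall>i. (\<Sum>j\<in>UNIV. \<bar>fst x $ i $ j\<bar>) < 1) \<and> (\<forall>i. fst (snd x) $ i > 0) \<and> (\<forall>i. snd (snd x) $ i > 0)}"

lemma open_contractive_params: "open contractive_params"
proof -
  have "contractive_params = (\<Inter>i. {x. (\<Sum>j\<in>UNIV. \<bar>fst x $ i $ j\<bar>) < 1}) \<inter>
      (\<Inter>i. {x. fst (snd x) $ i > 0}) \<inter> (\<Inter>i. {x. snd (snd x) $ i > 0})"
    by (auto simp: contractive_params_def)
  also have "open \<dots>"
    by (intro open_Int open_INT ballI open_Collect_less continuous_intros) auto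
  finally show ?thesis .
qed

lemma mask_contractive_params: "x \<in> contractive_params \<Longrightarrow> mask E x \<in> parameter_space E"
proof -
  assume x: "x \<in> contractive_params"
  have "(\<Sum>j\<in>UNIV. \<bar>fst (mask E x) $ i $ j\<bar>) < 1" for i
  proof -
    have "(\<Sum>j\<in>UNIV. \<bar>fst (mask E x) $ i $ j\<bar>) \<le> (\<Sum>j\<in>UNIV. \<bar>fst x $ i $ j\<bar>)"
      by (intro sum_mono) (auto simp: mask_def)
    then show ?thesis using x by (auto simp: contractive_params_def intro: le_less_trans)
  qed
  then have "schur_stable (fst (mask E x))" by (rule row_sum_schur_stable)
  then show ?thesis using x
    by (auto simp: parameter_space_def stable_graph_matrices_def graph_matrices_def mask_def
        contractive_params_def mem_Times_iff less_imp_neq[symmetric])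
qed

text \<open>Along the line through \<open>x0\<close> in direction \<open>h\<close> the cumulants are
  stationary. Differentiating their equations gives the kernel equations off the diagonal; on the
  diagonal, if \<open>fst h = 0\<close>, only the noise part of \<open>h\<close> remains and must
  vanish.\<close>

lemma cumulant_derivative_kernel:
  fixes x0 h :: "'n::finite param"
  assumes x0: "x0 \<in> contractive_params" "fst x0 \<in> graph_matrices E"
    and h: "fst h \<in> graph_matrices E"
    and deriv: "((\<lambda>x. cumulant_map (mask E x)) has_derivative \<phi>') (at x0)" and zero: "\<phi>' h = 0"
  defines "S \<equiv> second_cumulant (fst x0) (fst (snd x0))" and "T \<equiv> third_cumulant (fst x0) (snd (snd x0))"
  shows "cumulant_kernel (fst x0) S T (fst h)" and "fst h = 0 \<Longrightarrow> h = 0"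
proof -
  define x where "x t = x0 + t *\<^sub>R h" for t
  have mask_x: "mask E (x t) = x t" for t
    using x0 h unfolding mask_eq_iff by (simp add: x_def graph_matrices_def)
  define G where "G t = cumulant_map (x t)" for t
  have dx: "(x has_derivative (\<lambda>t. t *\<^sub>R h)) (at 0)"
    unfolding x_def by (auto intro!: derivative_eq_intros)
  have "x 0 = x0" by (simp add: x_def)
  then have "((\<lambda>t. cumulant_map (mask E (x t))) has_derivative (\<lambda>t. \<phi>' (t *\<^sub>R h))) (at 0)"
    using has_derivative_compose[OF dx, of "\<lambda>x. cumulant_map (mask E x)" \<phi>'] deriv by simp
  moreover have "\<phi>' (t *\<^sub>R h) = 0" for t
    using zero linear_scale[OF has_derivative_linear[OF deriv]] by simp
  ultimately have dG: "(G has_derivative (\<lambda>t. 0)) (at 0)"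
    by (simp add: mask_x G_def[abs_def])
  have dS: "((\<lambda>t. fst (G t) $ l $ m) has_real_derivative 0) (at 0)" for l m
    using bounded_linear.has_derivative[OF bounded_linear_compose[OF bounded_linear_vec_nth
      bounded_linear_compose[OF bounded_linear_vec_nth bounded_linear_fst]] dG, of l m]
    by (simp add: has_field_derivative_def o_def lambda_zero)
  have dT: "((\<lambda>t. snd (G t) $ l $ m $ q) has_real_derivative 0) (at 0)" for l m q
    using bounded_linear.has_derivative[OF bounded_linear_compose[OF bounded_linear_vec_nth bounded_linear_compose[OF bounded_linear_vec_nth
      bounded_linear_compose[OF bounded_linear_vec_nth bounded_linear_snd]]] dG, of l m q]
    by (simp add: has_field_derivative_def o_def lambda_zero)
  have "continuous_on UNIV x" unfolding x_def by (intro continuous_intros)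
  then have "open (x -` contractive_params)" by (rule open_vimage[OF open_contractive_params])
  \<comment> \<open>The cumulant equations are available for stable matrices only; openness keeps
    the line stable for small \<open>t\<close>.\<close>
  then have "\<forall>\<^sub>F t in nhds 0. t \<in> x -` contractive_params"
    by (rule eventually_nhds_in_open) (simp add: \<open>x 0 = x0\<close> x0(1))
  then have st: "\<forall>\<^sub>F t in nhds 0. schur_stable (fst (x t))"
    by eventually_elim (auto simp: contractive_params_def intro: row_sum_schur_stable)
  have G0: "fst (G 0) = S" "snd (G 0) = T"
    by (simp_all add: G_def x_def S_def T_def cumulant_map_def case_prod_unfold)
  have eqS: "(\<Sum>l\<in>UNIV. \<Sum>m\<in>UNIV. fst h $ i $ l * fst x0 $ j $ m * S $ l $ m)
      + (\<Sum>l\<in>UNIV. \<Sum>m\<in>UNIV. fst x0 $ i $ l * fst h $ j $ m * S $ l $ m)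
      + diag_matrix (fst (snd h)) $ i $ j = 0" for i j
    unfolding G0(1)[symmetric]
  proof (rule second_kernel_equation[where w = "diag_matrix (fst (snd x0)) $ i $ j", OF dS])
    show "\<forall>\<^sub>F t in nhds 0. fst (G t) $ i $ j = (\<Sum>l\<in>UNIV. \<Sum>m\<in>UNIV.
       (fst x0 $ i $ l + t * fst h $ i $ l) * (fst x0 $ j $ m + t * fst h $ j $ m) * fst (G t) $ l $ m)
       + (diag_matrix (fst (snd x0)) $ i $ j + t * diag_matrix (fst (snd h)) $ i $ j)"
      using st
    proof eventually_elim
      case (elim t)
      have "fst (G t) = second_cumulant (fst (x t)) (fst (snd (x t)))"
        by (simp add: G_def cumulant_map_def case_prod_unfold)
      then show ?case using second_cumulant_entry[OF elim, of "fst (snd (x t))" i j]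
        by (simp add: x_def diag_matrix_def)
    qed
  qed
  have eqT: "(\<Sum>l\<in>UNIV. \<Sum>m\<in>UNIV. \<Sum>q\<in>UNIV. fst h $ i $ l * fst x0 $ j $ m * fst x0 $ k $ q * T $ l $ m $ q)
      + (\<Sum>l\<in>UNIV. \<Sum>m\<in>UNIV. \<Sum>q\<in>UNIV. fst x0 $ i $ l * fst h $ j $ m * fst x0 $ k $ q * T $ l $ m $ q)
      + (\<Sum>l\<in>UNIV. \<Sum>m\<in>UNIV. \<Sum>q\<in>UNIV. fst x0 $ i $ l * fst x0 $ j $ m * fst h $ k $ q * T $ l $ m $ q)
      + diag_tensor (snd (snd h)) $ i $ j $ k = 0" for i j k
    unfolding G0(2)[symmetric]
  proof (rule third_kernel_equation[where w = "diag_tensor (snd (snd x0)) $ i $ j $ k", OF dT])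
    show "\<forall>\<^sub>F t in nhds 0. snd (G t) $ i $ j $ k = (\<Sum>l\<in>UNIV. \<Sum>m\<in>UNIV. \<Sum>q\<in>UNIV.
       (fst x0 $ i $ l + t * fst h $ i $ l) * (fst x0 $ j $ m + t * fst h $ j $ m) *
       (fst x0 $ k $ q + t * fst h $ k $ q) * snd (G t) $ l $ m $ q)
       + (diag_tensor (snd (snd x0)) $ i $ j $ k + t * diag_tensor (snd (snd h)) $ i $ j $ k)"
      using st
    proof eventually_elim
      case (elim t)
      have "snd (G t) = third_cumulant (fst (x t)) (snd (snd (x t)))"
        by (simp add: G_def cumulant_map_def case_prod_unfold)
      then show ?case using third_cumulant_entry[OF elim, of "snd (snd (x t))" i j k]
        by (simp add: x_def diag_tensor_def)
    qed
  qed
  show "cumulant_kernel (fst x0) S T (fst h)"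
    unfolding cumulant_kernel_def
  proof (intro conjI allI impI)
    fix i j :: 'n assume "i \<noteq> j"
    then show "(\<Sum>l\<in>UNIV. \<Sum>m\<in>UNIV. fst h $ i $ l * fst x0 $ j $ m * S $ l $ m)
      + (\<Sum>l\<in>UNIV. \<Sum>m\<in>UNIV. fst x0 $ i $ l * fst h $ j $ m * S $ l $ m) = 0"
      using eqS[of i j] by (simp add: diag_matrix_def)
  next
    fix i j k :: 'n assume "\<not> (i = j \<and> j = k)"
    then have "diag_tensor (snd (snd h)) $ i $ j $ k = 0" by (auto simp: diag_tensor_def)
    then show "(\<Sum>l\<in>UNIV. \<Sum>m\<in>UNIV. \<Sum>q\<in>UNIV. fst h $ i $ l * fst x0 $ j $ m * fst x0 $ k $ q * T $ l $ m $ q)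
      + (\<Sum>l\<in>UNIV. \<Sum>m\<in>UNIV. \<Sum>q\<in>UNIV. fst x0 $ i $ l * fst h $ j $ m * fst x0 $ k $ q * T $ l $ m $ q)
      + (\<Sum>l\<in>UNIV. \<Sum>m\<in>UNIV. \<Sum>q\<in>UNIV. fst x0 $ i $ l * fst x0 $ j $ m * fst h $ k $ q * T $ l $ m $ q) = 0"
      using eqT[of i j k] by simp
  qed
  show "h = 0" if "fst h = 0"
  proof -
    have "fst (snd h) $ i = 0" "snd (snd h) $ i = 0" for i
      using eqS[of i i] eqT[of i i i] that by (simp_all add: diag_matrix_def diag_tensor_def)
    then show ?thesis using that by (simp add: prod_eq_iff vec_eq_iff)
  qed
qed

theorem corollary5p9:
  fixes E :: "'n::finite rel"
  assumes "all_self_loops E"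
    and "\<forall>C \<in> connected_components E. card C \<ge> 2"
    and "\<forall>C \<in> connected_components E. card C = 2 \<longrightarrow> \<not> is_two_cycle C (induced_edges E C)"
  shows "generically_locally_identifiable E"
proof -
  obtain F where F: "rigid_orientation E F" using exists_rigid_orientation[OF assms] ..
  from exists_immersion_point[OF F] obtain e where
    e: "\<bar>e\<bar> \<le> 1 / (4 * real CARD('n))" and inj: "\<And>H. H \<in> graph_matrices E \<Longrightarrow>
      cumulant_kernel (fst (degenerate_param F e)) (second_cumulant (fst (degenerate_param F e)) (\<chi> i. 3/4))
      (third_cumulant (fst (degenerate_param F e)) (\<chi> i. 7/8)) H \<Longrightarrow> H = 0"
    by blast
  let ?x0 = "degenerate_param F e"
  obtain D and N :: "'n param \<Rightarrow> (real ^ 'n ^ 'n) \<times> (real ^ 'n ^ 'n ^ 'n)" where DN: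
    "real_polynomial_function D" "polynomial_function N"
    "\<And>\<theta>. schur_stable (fst \<theta>) \<Longrightarrow> D \<theta> \<noteq> 0 \<and> cumulant_map \<theta> = N \<theta> /\<^sub>R D \<theta>"
    by (rule cumulant_map_rational) (rule that)
  have stable: "schur_stable (fst \<theta>)" "fst \<theta> \<in> graph_matrices E" if "\<theta> \<in> parameter_space E" for \<theta>
    using that by (auto simp: parameter_space_def stable_graph_matrices_def)
  have x0: "?x0 \<in> contractive_params"
    using degenerate_param_row_sum[OF e, of F] by (simp add: contractive_params_def) (simp add: degenerate_param_def)
  \<comment> \<open>The diagonal entries \<open>1/2\<close> respect the graph because all self-loops
    are present.\<close>
  have x0E: "fst ?x0 \<in> graph_matrices E"
    using F assms(1) by (auto simp: rigid_orientation_def graph_matrices_def degenerate_param_def all_self_loops_def)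
  have "\<exists>z. real_polynomial_function z \<and> (\<exists>x\<in>parameter_space E. z x \<noteq> 0) \<and>
    (\<forall>x\<in>parameter_space E. z x \<noteq> 0 \<longrightarrow> finite {x' \<in> parameter_space E. cumulant_map x' = cumulant_map x})"
  \<comment> \<open>\<open>mask E\<close> plays the role of the projection \<open>\<pi>\<close> and
    \<open>contractive_params\<close> that of the open set \<open>W\<close>.\<close>
  proof (rule generic_finite_fibres[OF linear_mask[of E] mask_idem _ DN(1) _ DN(2) _ open_contractive_params x0 mask_contractive_params])
    show "mask E x = x" if "x \<in> parameter_space E" for x using stable[OF that] by (simp add: mask_eq_iff)
    show "D x \<noteq> 0" "cumulant_map x = N x /\<^sub>R D x" if "x \<in> parameter_space E" for x
      using DN(3) stable[OF that] by auto
    fix \<phi>' h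
    assume der: "((\<lambda>x. cumulant_map (mask E x)) has_derivative \<phi>') (at ?x0)" and h: "mask E h = h" "\<phi>' h = 0"
    have hE: "fst h \<in> graph_matrices E" using h by (simp add: mask_eq_iff)
    note kernel = cumulant_derivative_kernel[OF x0 x0E hE der h(2)]
    have "fst h = 0"
      using inj[OF hE] kernel(1) by (simp add: degenerate_param_def)
    then show "h = 0" by (rule kernel(2))
  qed auto
  then obtain z where z: "real_polynomial_function z" "\<exists>x\<in>parameter_space E. z x \<noteq> 0"
    "\<forall>x\<in>parameter_space E. z x \<noteq> 0 \<longrightarrow> finite {x' \<in> parameter_space E. cumulant_map x' = cumulant_map x}"
    by blast
  show ?thesis
    unfolding generically_locally_identifiable_def
  proof (intro exI[of _ "{x \<in> parameter_space E. z x = 0}"] conjI)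
    show "algebraic_subset (parameter_space E) {x \<in> parameter_space E. z x = 0}"
      unfolding algebraic_subset_def using z(1) by (intro exI[of _ "{z}"]) auto
  qed (use z(2,3) in auto)
qed

end
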